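(* Let $k,n\ge1$ and $A=R^n$. The affine structure on $A$ restricts to the $k$th-order i-structure $A_k$, making $A_k$ an i-affine subspace of the affine space $A$ (equipped with the indiscrete i-structure). That is, the operations $(\lambda,(P_1,\dots,P_p))\mapsto\sum_{j=1}^p\lambda_jP_j$ (usual affine combinations in $R^n$), for $p\in\mathbb{N}$, $\lambda\in\mathcal{A}(p)$ and $(P_1,\dots,P_p)\in A_k\langle p\rangle$, make $A$ with the i-structure $A_k$ an i-affine space over $R$, and the identity map from $A$ with $A_k$ to $A$ with the indiscrete i-structure is an i-affine map.
   Context: Setting: naive axiomatic Synthetic Differential Geometry, i.e. one argues intuitionistically (in the internal logic of a topos); "space" means a set/object of this universe and "map" an arbitrary map. $R$ is a commutative ring which is a $\mathbb{Q}$-algebra. For $k,n\ge 1$ let $D_k(n)=\{(d_1,\dots,d_n)\in R^n \mid \text{any product of } k+1 \text{ of the } d_j \text{ (repetitions allowed) vanishes}\}$. $R$ is assumed to satisfy the Kock–Lawvere axiom for all $D_k(n)$, $k,n\ge1$: every map $t:D_k(n)\to R$ is given by a uniquely determined polynomial in $R[X_1,\dots,X_n]$ of total degree $\le k$. An i-structure on a space $A$ is a family of subsets $A\langle p\rangle\subseteq A^p$ ($p\in\mathbb{N}$) such that (1) $A\langle 1\rangle=A$, $A\langle 0\rangle=A^0=1$; (2) for every map $h:\{1,\dots,m\}\to\{1,\dots,p\}$ and every $(P_1,\dots,P_p)\in A\langle p\rangle$ one has $(P_{h(1)},\dots,P_{h(m)})\in A\langle m\rangle$. The indiscrete i-structure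 is $A\langle p\rangle=A^p$. A map is an i-morphism if it maps i-$p$-tuples (elements of $A\langle p\rangle$) to i-$p$-tuples for all $p$. Let $\mathcal{A}(p)=\{(\lambda_1,\dots,\lambda_p)\in R^p\mid\sum_j\lambda_j=1\}$. An i-affine space over $R$ is a space $A$ with an i-structure and operations $\mathcal{A}(p)\times A\langle p\rangle\to A$, $(\lambda,(P_1,\dots,P_p))\mapsto\sum_j\lambda_jP_j$, $p\in\mathbb{N}$, satisfying: (Neighbourhood) for $\lambda^1,\dots,\lambda^m\in\mathcal{A}(p)$ and $(P_1,\dots,P_p)\in A\langle p\rangle$, $(\sum_j\lambda^1_jP_j,\dots,\sum_j\lambda^m_jP_j)\in A\langle m\rangle$; (Associativity) if moreover $\mu\in\mathcal{A}(m)$, then $\sum_{k}\mu_k(\sum_j\lambda^k_jP_j)=\sum_j(\sum_k\mu_k\lambda^k_j)P_j$; (Projection) for $p\ge1$, $1\le k\le p$ and the standard basis vector $e^p_k$, $\sum_j(e^p_k)_jP_j=P_k$. An i-affine map is an i-morphism preserving these operations. For $V=R^n$ put $\mathrm{DN}_k(V)=\{(v_1,\dots,v_{k+1})\in D_k(n)^{k+1}\mid \phi(v_1,\dots,v_{k+1})=0 \text{ for every } (k+1)\text{-linear map } \phi:V^{k+1}\to R\}$. The $k$th-order i-structure $A_k$ on $A=R^n$ is: $A_k\langle 1\rangle=A$, $A_k\langle 0\rangle=A^0=1$, and for $p\ge 2$, $A_k\langle p\rangle=\{(P_1,\dots,P_p)\in A^p\mid (P_{i_1}-P_{j_1},\dots,P_{i_{k+1}}-P_{j_{k+1}})\in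 \mathrm{DN}_k(V) \text{ for all } i_\ell,j_\ell\in\{1,\dots,p\},\ i_\ell\ne j_\ell,\ 1\le \ell\le k+1\}$. *)

theory Defs
  imports "HOL-Algebra.Ring" "HOL-Library.FuncSet" "HOL.Rat"
begin

text \<open>
  Synthetic differential geometry is intuitionistic: read with the classical functions and sets of
  HOL, the Kock-Lawvere axiom would force \<open>R\<close> to be the zero ring.  The ``universe of sets'' is
  therefore taken to be a topos of presheaves on an arbitrary small category \<open>C\<close>, and every notion
  below is the Kripke-Joyal (stagewise) interpretation of the naive one.  Objects of \<open>C\<close> are called
  stages.  A space \<open>X\<close> has a set of points (generalised elements) at every stage, and these are
  restricted along the arrows \<open>f : d \<rightarrow> c\<close>.  Two kinds of clauses change the stage: a universal
  quantifier over maps ranges over all later stages, and a map \<open>X \<rightarrow> Y\<close> existing at stage \<open>c\<close>, i.e.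
  a point of the exponential, is a natural family indexed by the arrows into \<open>c\<close>.

  The presheaves need not satisfy a gluing condition.  Since \<open>R\<close> may be a representable presheaf, a
  ring object in any small topos \<open>E\<close> is covered as well: take \<open>C = E\<close> and \<open>Hom(-, R)\<close>; points are
  then the generalised elements in \<open>E\<close>, and points of exponentials agree by the Yoneda lemma.
\<close>

section \<open>Spaces and maps\<close>

record ('o, 'm) cat =
  Ob :: "'o set"
  Arr :: "'m set"
  Dom :: "'m \<Rightarrow> 'o"
  Cod :: "'m \<Rightarrow> 'o"
  Ident :: "'o \<Rightarrow> 'm"
  Comp :: "'m \<Rightarrow> 'm \<Rightarrow> 'm"   \<comment> \<open>\<open>Comp g f\<close> is \<open>f\<close> followed by \<open>g\<close>\<close>

definition arrows :: "('o, 'm) cat \<Rightarrow> 'o \<Rightarrow> 'o \<Rightarrow> 'm set" where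
  "arrows C d c = {f \<in> Arr C. Dom C f = d \<and> Cod C f = c}"

definition small_category :: "('o, 'm) cat \<Rightarrow> bool" where
  "small_category C \<longleftrightarrow>
     (\<forall>f\<in>Arr C. Dom C f \<in> Ob C \<and> Cod C f \<in> Ob C) \<and>
     (\<forall>c\<in>Ob C. Ident C c \<in> arrows C c c) \<and>
     (\<forall>a b c f g. f \<in> arrows C a b \<longrightarrow> g \<in> arrows C b c \<longrightarrow> Comp C g f \<in> arrows C a c) \<and>
     (\<forall>a b f. f \<in> arrows C a b \<longrightarrow> Comp C f (Ident C a) = f \<and> Comp C (Ident C b) f = f) \<and>
     (\<forall>a b c d f g h. f \<in> arrows C a b \<longrightarrow> g \<in> arrows C b c \<longrightarrow> h \<in> arrows C c d \<longrightarrow>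
        Comp C h (Comp C g f) = Comp C (Comp C h g) f)"

record ('o, 'm, 's) space =
  pts :: "'o \<Rightarrow> 's set"
  rst :: "'m \<Rightarrow> 's \<Rightarrow> 's"

definition is_space :: "('o, 'm) cat \<Rightarrow> ('o, 'm, 's, 'x) space_scheme \<Rightarrow> bool" where
  "is_space C X \<longleftrightarrow>
     (\<forall>d c f x. f \<in> arrows C d c \<longrightarrow> x \<in> pts X c \<longrightarrow> rst X f x \<in> pts X d) \<and>
     (\<forall>c\<in>Ob C. \<forall>x\<in>pts X c. rst X (Ident C c) x = x) \<and>
     (\<forall>e d c f g x. g \<in> arrows C e d \<longrightarrow> f \<in> arrows C d c \<longrightarrow> x \<in> pts X c \<longrightarrow>
        rst X (Comp C f g) x = rst X g (rst X f x))"

definition is_subspace ::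
    "('o, 'm) cat \<Rightarrow> ('o, 'm, 's, 'x) space_scheme \<Rightarrow> ('o \<Rightarrow> 's set) \<Rightarrow> bool" where
  "is_subspace C X S \<longleftrightarrow>
     (\<forall>c\<in>Ob C. S c \<subseteq> pts X c) \<and>
     (\<forall>d c f x. f \<in> arrows C d c \<longrightarrow> x \<in> S c \<longrightarrow> rst X f x \<in> S d)"

text \<open>\<open>X\<^sup>p\<close>; tuples are functions on \<open>{..<p}\<close>, i.e. indices start at 0.\<close>

definition power_space :: "('o, 'm, 's, 'x) space_scheme \<Rightarrow> nat \<Rightarrow> ('o, 'm, nat \<Rightarrow> 's) space" where
  "power_space X p =
     \<lparr>pts = (\<lambda>c. {..<p} \<rightarrow>\<^sub>E pts X c), rst = (\<lambda>f P. \<lambda>i\<in>{..<p}. rst X f (P i))\<rparr>"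

text \<open>Maps of the universe (global elements of the exponential).\<close>

definition is_map ::
    "('o, 'm) cat \<Rightarrow> ('o, 'm, 's, 'x) space_scheme \<Rightarrow> ('o, 'm, 't, 'y) space_scheme \<Rightarrow>
     ('o \<Rightarrow> 's \<Rightarrow> 't) \<Rightarrow> bool" where
  "is_map C X Y t \<longleftrightarrow>
     (\<forall>c\<in>Ob C. \<forall>x\<in>pts X c. t c x \<in> pts Y c) \<and>
     (\<forall>d c f x. f \<in> arrows C d c \<longrightarrow> x \<in> pts X c \<longrightarrow> rst Y f (t c x) = t d (rst X f x))"

text \<open>Maps at stage \<open>c\<close> (points at stage \<open>c\<close> of the exponential): the component \<open>t f\<close> acts on the
  points of \<open>X\<close> at the domain of \<open>f\<close>.\<close>

definition maps_at ::
    "('o, 'm) cat \<Rightarrow> ('o, 'm, 's, 'x) space_scheme \<Rightarrow> ('o, 'm, 't, 'y) space_scheme \<Rightarrow>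
     'o \<Rightarrow> ('m \<Rightarrow> 's \<Rightarrow> 't) set" where
  "maps_at C X Y c = {t.
     (\<forall>d f x. f \<in> arrows C d c \<longrightarrow> x \<in> pts X d \<longrightarrow> t f x \<in> pts Y d) \<and>
     (\<forall>e d f g x. g \<in> arrows C e d \<longrightarrow> f \<in> arrows C d c \<longrightarrow> x \<in> pts X d \<longrightarrow>
        rst Y g (t f x) = t (Comp C f g) (rst X g x))}"


section \<open>Linear algebra over an ordinary commutative ring, used stagewise\<close>

definition vec :: "'r ring \<Rightarrow> nat \<Rightarrow> (nat \<Rightarrow> 'r) set" where
  "vec S n = ({..<n} \<rightarrow>\<^sub>E carrier S)"

definition vadd :: "'r ring \<Rightarrow> nat \<Rightarrow> (nat \<Rightarrow> 'r) \<Rightarrow> (nat \<Rightarrow> 'r) \<Rightarrow> (nat \<Rightarrow> 'r)" where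
  "vadd S n v w = (\<lambda>i\<in>{..<n}. v i \<oplus>\<^bsub>S\<^esub> w i)"

definition vdiff :: "'r ring \<Rightarrow> nat \<Rightarrow> (nat \<Rightarrow> 'r) \<Rightarrow> (nat \<Rightarrow> 'r) \<Rightarrow> (nat \<Rightarrow> 'r)" where
  "vdiff S n v w = (\<lambda>i\<in>{..<n}. v i \<ominus>\<^bsub>S\<^esub> w i)"

definition vscale :: "'r ring \<Rightarrow> nat \<Rightarrow> 'r \<Rightarrow> (nat \<Rightarrow> 'r) \<Rightarrow> (nat \<Rightarrow> 'r)" where
  "vscale S n a v = (\<lambda>i\<in>{..<n}. a \<otimes>\<^bsub>S\<^esub> v i)"

definition multilinear :: "'r ring \<Rightarrow> nat \<Rightarrow> nat \<Rightarrow> ((nat \<Rightarrow> nat \<Rightarrow> 'r) \<Rightarrow> 'r) \<Rightarrow> bool" where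
  "multilinear S n q \<phi> \<longleftrightarrow>
     (\<forall>v \<in> {..<q} \<rightarrow>\<^sub>E vec S n. \<forall>l<q. \<forall>u\<in>vec S n. \<forall>w\<in>vec S n. \<forall>a\<in>carrier S.
        \<phi> (v(l := vadd S n u w)) = \<phi> (v(l := u)) \<oplus>\<^bsub>S\<^esub> \<phi> (v(l := w)) \<and>
        \<phi> (v(l := vscale S n a u)) = a \<otimes>\<^bsub>S\<^esub> \<phi> (v(l := u)))"

text \<open>Polynomials in \<open>n\<close> variables of total degree \<open>\<le> k\<close>, given by their coefficients.\<close>

definition exponents :: "nat \<Rightarrow> nat \<Rightarrow> (nat \<Rightarrow> nat) set" where
  "exponents n k = {\<alpha> \<in> {..<n} \<rightarrow>\<^sub>E UNIV. (\<Sum>i<n. \<alpha> i) \<le> k}"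

definition polys :: "'r ring \<Rightarrow> nat \<Rightarrow> nat \<Rightarrow> ((nat \<Rightarrow> nat) \<Rightarrow> 'r) set" where
  "polys S n k = (exponents n k \<rightarrow>\<^sub>E carrier S)"

definition poly_value ::
    "'r ring \<Rightarrow> nat \<Rightarrow> nat \<Rightarrow> ((nat \<Rightarrow> nat) \<Rightarrow> 'r) \<Rightarrow> (nat \<Rightarrow> 'r) \<Rightarrow> 'r" where
  "poly_value S n k a x =
     (\<Oplus>\<^bsub>S\<^esub>\<alpha>\<in>exponents n k. a \<alpha> \<otimes>\<^bsub>S\<^esub> (\<Otimes>\<^bsub>S\<^esub>i\<in>{..<n}. x i [^]\<^bsub>S\<^esub> \<alpha> i))"

definition affine_coeffs :: "'r ring \<Rightarrow> nat \<Rightarrow> (nat \<Rightarrow> 'r) set" where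
  "affine_coeffs S p = {l \<in> {..<p} \<rightarrow>\<^sub>E carrier S. (\<Oplus>\<^bsub>S\<^esub>j\<in>{..<p}. l j) = \<one>\<^bsub>S\<^esub>}"

definition affine_comb ::
    "'r ring \<Rightarrow> nat \<Rightarrow> nat \<Rightarrow> (nat \<Rightarrow> 'r) \<Rightarrow> (nat \<Rightarrow> nat \<Rightarrow> 'r) \<Rightarrow> (nat \<Rightarrow> 'r)" where
  "affine_comb S n p l P = (\<lambda>i\<in>{..<n}. \<Oplus>\<^bsub>S\<^esub>j\<in>{..<p}. l j \<otimes>\<^bsub>S\<^esub> P j i)"

definition rat_ring :: "rat ring" where
  "rat_ring = \<lparr>carrier = UNIV, mult = (*), one = 1, zero = 0, add = (+)\<rparr>"


section \<open>The ring of the synthetic universe\<close>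

record ('o, 'm, 'r) ring_object =
  ring_at :: "'o \<Rightarrow> 'r ring"
  ring_rst :: "'m \<Rightarrow> 'r \<Rightarrow> 'r"

definition line :: "('o, 'm, 'r) ring_object \<Rightarrow> ('o, 'm, 'r) space" where
  "line R = \<lparr>pts = (\<lambda>c. carrier (ring_at R c)), rst = ring_rst R\<rparr>"

text \<open>Ring homomorphisms out of the rationals are unique, so the algebra structure is a property
  and is automatically compatible with restriction.\<close>

definition rational_algebra :: "('o, 'm) cat \<Rightarrow> ('o, 'm, 'r) ring_object \<Rightarrow> bool" where
  "rational_algebra C R \<longleftrightarrow>
     is_space C (line R) \<and>
     (\<forall>c\<in>Ob C. cring (ring_at R c) \<and> ring_hom rat_ring (ring_at R c) \<noteq> {}) \<and>
     (\<forall>d c f. f \<in> arrows C d c \<longrightarrow> ring_rst R f \<in> ring_hom (ring_at R c) (ring_at R d))"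

definition Rn :: "('o, 'm, 'r) ring_object \<Rightarrow> nat \<Rightarrow> ('o, 'm, nat \<Rightarrow> 'r) space" where
  "Rn R n = power_space (line R) n"

definition D :: "('o, 'm, 'r) ring_object \<Rightarrow> nat \<Rightarrow> nat \<Rightarrow> ('o, 'm, nat \<Rightarrow> 'r) space" where
  "D R k n = (Rn R n)\<lparr>pts := (\<lambda>c. {x \<in> pts (Rn R n) c.
     \<forall>i \<in> {..<k+1} \<rightarrow> {..<n}. (\<Otimes>\<^bsub>ring_at R c\<^esub>l\<in>{..<k+1}. x (i l)) = \<zero>\<^bsub>ring_at R c\<^esub>})\<rparr>"

text \<open>Unique existence at stage \<open>c\<close> suffices: \<open>t\<close> restricted to a later stage is again a map at that
  stage, so uniqueness holds there, too.\<close>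

definition kock_lawvere :: "('o, 'm) cat \<Rightarrow> ('o, 'm, 'r) ring_object \<Rightarrow> bool" where
  "kock_lawvere C R \<longleftrightarrow>
     (\<forall>k\<ge>1. \<forall>n\<ge>1. \<forall>c\<in>Ob C. \<forall>t \<in> maps_at C (D R k n) (line R) c.
        \<exists>!a. a \<in> polys (ring_at R c) n k \<and>
          (\<forall>d f x. f \<in> arrows C d c \<longrightarrow> x \<in> pts (D R k n) d \<longrightarrow>
             t f x = poly_value (ring_at R d) n k (\<lambda>\<alpha>. ring_rst R f (a \<alpha>)) x))"


section \<open>i-structures and i-affine spaces\<close>

definition i_structure ::
    "('o, 'm) cat \<Rightarrow> ('o, 'm, 's, 'x) space_scheme \<Rightarrow> (nat \<Rightarrow> 'o \<Rightarrow> (nat \<Rightarrow> 's) set) \<Rightarrow> bool" where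
  "i_structure C X T \<longleftrightarrow>
     (\<forall>p. is_subspace C (power_space X p) (T p)) \<and>
     (\<forall>c\<in>Ob C. T 1 c = pts (power_space X 1) c \<and> T 0 c = pts (power_space X 0) c) \<and>
     (\<forall>m p. \<forall>h \<in> {..<m} \<rightarrow> {..<p}. \<forall>c\<in>Ob C. \<forall>P \<in> T p c. (\<lambda>i\<in>{..<m}. P (h i)) \<in> T m c)"

definition indiscrete :: "('o, 'm, 's, 'x) space_scheme \<Rightarrow> nat \<Rightarrow> 'o \<Rightarrow> (nat \<Rightarrow> 's) set" where
  "indiscrete X p c = pts (power_space X p) c"

record ('o, 'm, 'r, 's) i_affine_data = "('o, 'm, 's) space" +
  tuples :: "nat \<Rightarrow> 'o \<Rightarrow> (nat \<Rightarrow> 's) set"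
  comb :: "nat \<Rightarrow> 'o \<Rightarrow> (nat \<Rightarrow> 'r) \<Rightarrow> (nat \<Rightarrow> 's) \<Rightarrow> 's"

text \<open>The conjuncts after the first two say: \<open>comb p\<close> is a map \<open>\<A>(p) \<times> A\<langle>p\<rangle> \<rightarrow> A\<close> (values, naturality);
  neighbourhood; associativity; projection.\<close>

definition i_affine_space ::
    "('o, 'm) cat \<Rightarrow> ('o, 'm, 'r) ring_object \<Rightarrow> ('o, 'm, 'r, 's) i_affine_data \<Rightarrow> bool" where
  "i_affine_space C R A \<longleftrightarrow>
     is_space C A \<and>
     i_structure C A (tuples A) \<and>
     (\<forall>p. \<forall>c\<in>Ob C. \<forall>l \<in> affine_coeffs (ring_at R c) p. \<forall>P \<in> tuples A p c.
        comb A p c l P \<in> pts A c) \<and>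
     (\<forall>p d c f. f \<in> arrows C d c \<longrightarrow> (\<forall>l \<in> affine_coeffs (ring_at R c) p. \<forall>P \<in> tuples A p c.
        rst A f (comb A p c l P)
          = comb A p d (rst (power_space (line R) p) f l) (rst (power_space A p) f P))) \<and>
     (\<forall>m p. \<forall>c\<in>Ob C. \<forall>L \<in> {..<m} \<rightarrow> affine_coeffs (ring_at R c) p. \<forall>P \<in> tuples A p c.
        (\<lambda>k\<in>{..<m}. comb A p c (L k) P) \<in> tuples A m c) \<and>
     (\<forall>m p. \<forall>c\<in>Ob C. \<forall>L \<in> {..<m} \<rightarrow> affine_coeffs (ring_at R c) p. \<forall>P \<in> tuples A p c.
        \<forall>\<mu> \<in> affine_coeffs (ring_at R c) m.
        comb A m c \<mu> (\<lambda>k\<in>{..<m}. comb A p c (L k) P)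
          = comb A p c (\<lambda>j\<in>{..<p}. \<Oplus>\<^bsub>ring_at R c\<^esub>k\<in>{..<m}. \<mu> k \<otimes>\<^bsub>ring_at R c\<^esub> L k j) P) \<and>
     (\<forall>p\<ge>1. \<forall>k<p. \<forall>c\<in>Ob C. \<forall>P \<in> tuples A p c.
        comb A p c (\<lambda>j\<in>{..<p}. if j = k then \<one>\<^bsub>ring_at R c\<^esub> else \<zero>\<^bsub>ring_at R c\<^esub>) P = P k)"

definition i_morphism ::
    "('o, 'm) cat \<Rightarrow> ('o, 'm, 'r, 's) i_affine_data \<Rightarrow> ('o, 'm, 'r, 't) i_affine_data \<Rightarrow>
     ('o \<Rightarrow> 's \<Rightarrow> 't) \<Rightarrow> bool" where
  "i_morphism C A B t \<longleftrightarrow>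
     is_map C A B t \<and>
     (\<forall>p. \<forall>c\<in>Ob C. \<forall>P \<in> tuples A p c. (\<lambda>j\<in>{..<p}. t c (P j)) \<in> tuples B p c)"

definition i_affine_map ::
    "('o, 'm) cat \<Rightarrow> ('o, 'm, 'r) ring_object \<Rightarrow>
     ('o, 'm, 'r, 's) i_affine_data \<Rightarrow> ('o, 'm, 'r, 't) i_affine_data \<Rightarrow>
     ('o \<Rightarrow> 's \<Rightarrow> 't) \<Rightarrow> bool" where
  "i_affine_map C R A B t \<longleftrightarrow>
     i_morphism C A B t \<and>
     (\<forall>p. \<forall>c\<in>Ob C. \<forall>l \<in> affine_coeffs (ring_at R c) p. \<forall>P \<in> tuples A p c.
        t c (comb A p c l P) = comb B p c l (\<lambda>j\<in>{..<p}. t c (P j)))"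


section \<open>The higher-order i-structures on \<open>R\<^sup>n\<close>\<close>

text \<open>Points at stage \<open>c\<close> of the space of \<open>q\<close>-linear maps from \<open>V\<^sup>q\<close> to \<open>R\<close>, \<open>V = R\<^sup>n\<close>.\<close>

definition multilinear_maps_at ::
    "('o, 'm) cat \<Rightarrow> ('o, 'm, 'r) ring_object \<Rightarrow> nat \<Rightarrow> nat \<Rightarrow> 'o \<Rightarrow>
     ('m \<Rightarrow> (nat \<Rightarrow> nat \<Rightarrow> 'r) \<Rightarrow> 'r) set" where
  "multilinear_maps_at C R n q c = {\<phi> \<in> maps_at C (power_space (Rn R n) q) (line R) c.
     \<forall>d f. f \<in> arrows C d c \<longrightarrow> multilinear (ring_at R d) n q (\<phi> f)}"

text \<open>The current value of a map \<open>\<phi>\<close> at stage \<open>d\<close> is its component at the identity of \<open>d\<close>.\<close>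

definition DN ::
    "('o, 'm) cat \<Rightarrow> ('o, 'm, 'r) ring_object \<Rightarrow> nat \<Rightarrow> nat \<Rightarrow> 'o \<Rightarrow> (nat \<Rightarrow> nat \<Rightarrow> 'r) set" where
  "DN C R k n c = {v \<in> {..<k+1} \<rightarrow>\<^sub>E pts (D R k n) c.
     \<forall>d f. f \<in> arrows C d c \<longrightarrow> (\<forall>\<phi> \<in> multilinear_maps_at C R n (k+1) d.
       \<phi> (Ident C d) (rst (power_space (Rn R n) (k+1)) f v) = \<zero>\<^bsub>ring_at R d\<^esub>)}"

definition kth_order ::
    "('o, 'm) cat \<Rightarrow> ('o, 'm, 'r) ring_object \<Rightarrow> nat \<Rightarrow> nat \<Rightarrow>
     nat \<Rightarrow> 'o \<Rightarrow> (nat \<Rightarrow> nat \<Rightarrow> 'r) set" where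
  "kth_order C R k n p c =
     (if p < 2 then pts (power_space (Rn R n) p) c
      else {P \<in> pts (power_space (Rn R n) p) c.
        \<forall>i \<in> {..<k+1} \<rightarrow> {..<p}. \<forall>j \<in> {..<k+1} \<rightarrow> {..<p}. (\<forall>l<k+1. i l \<noteq> j l) \<longrightarrow>
          (\<lambda>l\<in>{..<k+1}. vdiff (ring_at R c) n (P (i l)) (P (j l))) \<in> DN C R k n c})"

text \<open>\<open>R\<^sup>n\<close> with its usual affine combinations and a given i-structure.\<close>

definition affine_Rn ::
    "('o, 'm, 'r) ring_object \<Rightarrow> nat \<Rightarrow> (nat \<Rightarrow> 'o \<Rightarrow> (nat \<Rightarrow> nat \<Rightarrow> 'r) set) \<Rightarrow>
     ('o, 'm, 'r, nat \<Rightarrow> 'r) i_affine_data" where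
  "affine_Rn R n T =
     \<lparr>pts = pts (Rn R n), rst = rst (Rn R n), tuples = T,
      comb = (\<lambda>p c. affine_comb (ring_at R c) n p)\<rparr>"

end

theory Submission
  imports Defs "HOL-Algebra.Ideal"
begin

text \<open>
  The whole theorem rests on a description of \<open>A\<^sub>k\<langle>p\<rangle>\<close> by equations between coordinates.  A point of
  \<open>DN\<^sub>k(R\<^sup>n)\<close> is killed by all \<open>(k+1)\<close>-linear forms.  Products of coordinates, one coordinate from each
  argument, are such forms, and expanding a form in the standard basis writes it as a linear
  combination of these products; so being killed by all forms means that all these products vanish
  (\<open>DN_iff\<close>).  Consequently \<open>(P\<^sub>1, \<dots>, P\<^sub>p)\<close> belongs to \<open>A\<^sub>k\<langle>p\<rangle>\<close> exactly if every product of \<open>k+1\<close>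
  factors, each of them a coordinate of a difference of two of the \<open>P\<^sub>j\<close>, is zero (\<open>kth_order_iff\<close>).
  The condition that the differences lie in \<open>D\<^sub>k(n)\<close> is the case in which the same two points are
  used in all factors.  A product with a pair of equal points has a factor zero, so equal indices can
  be admitted, and the description also covers \<open>p < 2\<close>.

  Equations of this kind survive ring homomorphisms, hence a change of stage, and the reindexing of
  tuples; so \<open>A\<^sub>k\<close> is an i-structure.  The one axiom with content is the neighbourhood axiom.  Since the
  coefficients of an affine combination sum to one, a coordinate of the difference of two affine
  combinations of the \<open>P\<^sub>j\<close> lies in the ideal generated by the same coordinate of the differences
  \<open>P\<^sub>a - P\<^sub>b\<close> (\<open>affine_sum_diff_mem_ideal\<close>).  A product of elements of ideals vanishes as soon as all
  products of generators do (\<open>prod_genideal_vanishes\<close>), and the products of generators are those in the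
  description of \<open>A\<^sub>k\<langle>p\<rangle>\<close>.  Values, naturality, associativity and projection are the usual facts on
  affine combinations, shared by \<open>A\<^sub>k\<close> and the indiscrete i-structure.
\<close>

section \<open>Products of linear combinations\<close>

lemma (in cring) finprod_lessThan_Suc:
  assumes "f \<in> {..<Suc q} \<rightarrow> carrier R"
  shows "(\<Otimes>l\<in>{..<Suc q}. f l) = (\<Otimes>l\<in>{..<q}. f l) \<otimes> f q"
proof -
  have "(\<Otimes>l\<in>insert q {..<q}. f l) = f q \<otimes> (\<Otimes>l\<in>{..<q}. f l)"
    using assms by (intro finprod_insert) auto
  also have "\<dots> = (\<Otimes>l\<in>{..<q}. f l) \<otimes> f q"
    using assms by (intro m_comm finprod_closed) auto
  finally show ?thesis by (simp add: lessThan_Suc)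
qed

lemma (in abelian_monoid) finsum_lessThan_Suc:
  assumes "f \<in> {..<Suc q} \<rightarrow> carrier G"
  shows "(\<Oplus>l\<in>{..<Suc q}. f l) = (\<Oplus>l\<in>{..<q}. f l) \<oplus> f q"
proof -
  have "(\<Oplus>l\<in>insert q {..<q}. f l) = f q \<oplus> (\<Oplus>l\<in>{..<q}. f l)"
    using assms by (intro finsum_insert) auto
  also have "\<dots> = (\<Oplus>l\<in>{..<q}. f l) \<oplus> f q"
    using assms by (intro a_comm finsum_closed) auto
  finally show ?thesis by (simp add: lessThan_Suc)
qed

lemma (in cring) finprod_lessThan_eq_zero:
  fixes q :: nat
  assumes "f \<in> {..<q} \<rightarrow> carrier R" "l < q" "f l = \<zero>"
  shows "(\<Otimes>l\<in>{..<q}. f l) = \<zero>"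
proof -
  have "(\<Otimes>l\<in>{..<q}. f l) = (\<Otimes>l\<in>insert l ({..<q} - {l}). f l)"
    using assms(2) by (simp add: insert_absorb)
  also have "\<dots> = f l \<otimes> (\<Otimes>l\<in>{..<q} - {l}. f l)"
    using assms by (intro finprod_insert) auto
  also have "\<dots> = \<zero>"
    using assms(1) by (subst assms(3)) (intro l_null finprod_closed, auto)
  finally show ?thesis .
qed

lemma (in cring) annihilator_ideal:
  assumes "c \<in> carrier R"
  shows "ideal {x \<in> carrier R. c \<otimes> x = \<zero>} R"
proof (rule idealI)
  show "ring R" by (rule ring_axioms)
  show "subgroup {x \<in> carrier R. c \<otimes> x = \<zero>} (add_monoid R)"
    using assms by (intro add.subgroupI)
      (auto simp: r_distr r_minus a_inv_def[symmetric] intro!: exI[of _ \<zero>])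
next
  fix a x assume "a \<in> {x \<in> carrier R. c \<otimes> x = \<zero>}" "x \<in> carrier R"
  then have a: "a \<in> carrier R" "x \<in> carrier R" "c \<otimes> a = \<zero>" by auto
  have "c \<otimes> (a \<otimes> x) = (c \<otimes> a) \<otimes> x" using a assms by (intro m_assoc[symmetric])
  also have "\<dots> = \<zero>" using a by simp
  finally have *: "c \<otimes> (a \<otimes> x) = \<zero>" .
  then show "a \<otimes> x \<in> {x \<in> carrier R. c \<otimes> x = \<zero>}" using a by simp
  show "x \<otimes> a \<in> {x \<in> carrier R. c \<otimes> x = \<zero>}" using * a by (simp add: m_comm)
qed

text \<open>
  Replace the generators by ideal elements one factor at a time: with all other factors fixed, the
  admissible values of one factor form an annihilator, which is an ideal.  The extra factor \<open>c\<close>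
  carries the already chosen generators through the induction.
\<close>

lemma (in cring) prod_genideal_vanishes:
  fixes q :: nat
  assumes "c \<in> carrier R" "\<And>l. l < q \<Longrightarrow> Y l \<subseteq> carrier R"
    and "\<And>y. y \<in> (\<Pi> l\<in>{..<q}. Y l) \<Longrightarrow> c \<otimes> (\<Otimes>l\<in>{..<q}. y l) = \<zero>"
    and "\<And>l. l < q \<Longrightarrow> x l \<in> Idl (Y l)"
  shows "c \<otimes> (\<Otimes>l\<in>{..<q}. x l) = \<zero>"
  using assms
proof (induction q arbitrary: c)
  case 0
  then show ?case by auto
next
  case (Suc q)
  note c = Suc.prems(1)
  have carr: "x l \<in> carrier R" if "l < Suc q" for l
    using Suc.prems(2,4)[OF that] by (meson genideal_ideal ideal.Icarr)
  define X where "X = (\<Otimes>l\<in>{..<q}. x l)"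
  have X: "X \<in> carrier R" unfolding X_def using carr by (intro finprod_closed) auto
  \<comment> \<open>For a generator \<open>z\<close> in the last place, the induction hypothesis applies with \<open>c \<otimes> z\<close> for \<open>c\<close>.\<close>
  have "Y q \<subseteq> {z \<in> carrier R. (c \<otimes> X) \<otimes> z = \<zero>}"
  proof
    fix z assume z: "z \<in> Y q"
    then have zc: "z \<in> carrier R" using Suc.prems(2) by auto
    have "(c \<otimes> z) \<otimes> (\<Otimes>l\<in>{..<q}. x l) = \<zero>"
    proof (rule Suc.IH)
      fix y assume y: "y \<in> (\<Pi> l\<in>{..<q}. Y l)"
      have yc: "y \<in> {..<q} \<rightarrow> carrier R"
      proof
        fix l assume "l \<in> {..<q}"
        then have "y l \<in> Y l" "Y l \<subseteq> carrier R" using y Suc.prems(2)[of l] by auto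
        then show "y l \<in> carrier R" by auto
      qed
      then have pc: "(\<Otimes>l\<in>{..<q}. y l) \<in> carrier R" by (rule finprod_closed)
      have "y(q := z) \<in> (\<Pi> l\<in>{..<Suc q}. Y l)"
        using y z by (auto simp: less_Suc_eq)
      from Suc.prems(3)[OF this]
      have "c \<otimes> (\<Otimes>l\<in>{..<Suc q}. (y(q := z)) l) = \<zero>" .
      also have "(\<Otimes>l\<in>{..<Suc q}. (y(q := z)) l) = (\<Otimes>l\<in>{..<q}. (y(q := z)) l) \<otimes> z"
        using yc zc by (subst finprod_lessThan_Suc) (auto simp: less_Suc_eq)
      also have "(\<Otimes>l\<in>{..<q}. (y(q := z)) l) = (\<Otimes>l\<in>{..<q}. y l)"
        using yc by (intro finprod_cong') auto
      finally show "(c \<otimes> z) \<otimes> (\<Otimes>l\<in>{..<q}. y l) = \<zero>"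
        using c zc pc by (simp add: m_ac)
    qed (use c zc Suc.prems in auto)
    then show "z \<in> {z \<in> carrier R. (c \<otimes> X) \<otimes> z = \<zero>}"
      using c zc X by (simp add: m_ac X_def[symmetric])
  qed
  then have "Idl (Y q) \<subseteq> {z \<in> carrier R. (c \<otimes> X) \<otimes> z = \<zero>}"
    using c X by (intro genideal_minimal annihilator_ideal) auto
  then have "(c \<otimes> X) \<otimes> x q = \<zero>" using Suc.prems(4)[of q] by auto
  moreover have "(\<Otimes>l\<in>{..<Suc q}. x l) = X \<otimes> x q"
    unfolding X_def using carr by (intro finprod_lessThan_Suc) auto
  ultimately show ?case using c X carr by (simp add: m_assoc)
qed

lemma (in ideal) finsum_in_ideal:
  assumes "\<And>j. j < (p::nat) \<Longrightarrow> f j \<in> I"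
  shows "(\<Oplus>j\<in>{..<p}. f j) \<in> I"
  using assms
proof (induction p)
  case 0
  then show ?case by simp
next
  case (Suc p)
  have "(\<Oplus>j\<in>{..<Suc p}. f j) = (\<Oplus>j\<in>{..<p}. f j) \<oplus> f p"
    using Suc.prems Icarr by (intro finsum_lessThan_Suc) auto
  then show ?case using Suc by simp
qed

text \<open>
  As the coefficients sum to one, \<open>\<Sum> l\<^sub>j y\<^sub>j - z = \<Sum> l\<^sub>j (y\<^sub>j - z)\<close>.
\<close>

lemma (in cring) affine_sum_minus_mem_ideal:
  assumes "ideal I R" "l \<in> {..<p::nat} \<rightarrow> carrier R" "(\<Oplus>j\<in>{..<p}. l j) = \<one>"
    and "y \<in> {..<p} \<rightarrow> carrier R" "z \<in> carrier R"
    and "\<And>j. j < p \<Longrightarrow> y j \<ominus> z \<in> I"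
  shows "(\<Oplus>j\<in>{..<p}. l j \<otimes> y j) \<ominus> z \<in> I"
proof -
  interpret ideal I R by fact
  have l: "l j \<in> carrier R" if "j < p" for j
    using assms(2) that by auto
  have y: "y j \<in> carrier R" if "j < p" for j
    using assms(4) that by auto
  have "z = (\<Oplus>j\<in>{..<p}. l j) \<otimes> z"
    using assms(3,5) by simp
  also have "\<dots> = (\<Oplus>j\<in>{..<p}. l j \<otimes> z)"
    using l assms(5) by (intro finsum_ldistr) auto
  finally have z: "(\<Oplus>j\<in>{..<p}. l j \<otimes> z) = z" by simp
  have "(\<Oplus>j\<in>{..<p}. l j \<otimes> y j) = (\<Oplus>j\<in>{..<p}. l j \<otimes> (y j \<ominus> z) \<oplus> l j \<otimes> z)"
  proof (rule add.finprod_cong')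
    fix j assume "j \<in> {..<p}"
    then have j: "l j \<in> carrier R" "y j \<in> carrier R" using l y by auto
    then show "l j \<otimes> y j = l j \<otimes> (y j \<ominus> z) \<oplus> l j \<otimes> z"
      using assms(5) by algebra
  qed (use l y assms(5) in auto)
  also have "\<dots> = (\<Oplus>j\<in>{..<p}. l j \<otimes> (y j \<ominus> z)) \<oplus> (\<Oplus>j\<in>{..<p}. l j \<otimes> z)"
    using l y assms(5) by (intro finsum_addf) auto
  finally have "(\<Oplus>j\<in>{..<p}. l j \<otimes> y j) = (\<Oplus>j\<in>{..<p}. l j \<otimes> (y j \<ominus> z)) \<oplus> z"
    by (simp add: z)
  moreover have "(\<Oplus>j\<in>{..<p}. l j \<otimes> (y j \<ominus> z)) \<in> I"
    using assms(6) l by (intro finsum_in_ideal I_l_closed) auto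
  moreover have "s \<oplus> z \<ominus> z = s" if "s \<in> carrier R" for s
    using that assms(5) by algebra
  ultimately show ?thesis by (simp add: Icarr)
qed

text \<open>
  The preceding lemma, used twice: first with \<open>z\<close> one of the entries \<open>y\<^sub>a\<close>, then with \<open>z\<close> the second
  affine sum.  No entry has to be singled out as a base point, so \<open>p = 0\<close>, which can occur over the
  zero ring, is included.
\<close>

lemma (in cring) affine_sum_diff_mem_ideal:
  assumes "ideal I R" "l \<in> {..<p::nat} \<rightarrow> carrier R" "(\<Oplus>j\<in>{..<p}. l j) = \<one>"
    and "l' \<in> {..<p} \<rightarrow> carrier R" "(\<Oplus>j\<in>{..<p}. l' j) = \<one>"
    and "y \<in> {..<p} \<rightarrow> carrier R"
    and "\<And>a b. a < p \<Longrightarrow> b < p \<Longrightarrow> y a \<ominus> y b \<in> I"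
  shows "(\<Oplus>j\<in>{..<p}. l j \<otimes> y j) \<ominus> (\<Oplus>j\<in>{..<p}. l' j \<otimes> y j) \<in> I"
proof -
  interpret ideal I R by fact
  define z where "z = (\<Oplus>j\<in>{..<p}. l' j \<otimes> y j)"
  have sc: "(\<Oplus>j\<in>{..<p}. l'' j \<otimes> y j) \<in> carrier R" if "l'' \<in> {..<p} \<rightarrow> carrier R" for l''
    using that assms(6) by (intro finsum_closed) auto
  have z: "z \<in> carrier R" unfolding z_def by (rule sc) fact
  have "y a \<ominus> z \<in> I" if a: "a < p" for a
  proof -
    have ya: "y a \<in> carrier R" using a assms(6) by auto
    have "z \<ominus> y a \<in> I"
      unfolding z_def using a assms ya by (intro affine_sum_minus_mem_ideal) auto
    then have "\<ominus> (z \<ominus> y a) \<in> I" by simp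
    moreover have "\<ominus> (z \<ominus> y a) = y a \<ominus> z" using z ya by algebra
    ultimately show ?thesis by simp
  qed
  then show ?thesis
    unfolding z_def[symmetric] using assms z by (intro affine_sum_minus_mem_ideal) auto
qed

text \<open>One coordinate of the associativity axiom.\<close>

lemma (in cring) finsum_nested:
  assumes "\<mu> \<in> {..<m} \<rightarrow> carrier R" "\<And>k j. k < m \<Longrightarrow> j < p \<Longrightarrow> L k j \<in> carrier R"
    and "x \<in> {..<p} \<rightarrow> carrier R"
  shows "(\<Oplus>k\<in>{..<m::nat}. \<mu> k \<otimes> (\<Oplus>j\<in>{..<p::nat}. L k j \<otimes> x j)) =
         (\<Oplus>j\<in>{..<p}. (\<Oplus>k\<in>{..<m}. \<mu> k \<otimes> L k j) \<otimes> x j)"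
  using assms(1,2)
proof (induction m)
  case 0
  have "(\<Oplus>j\<in>{..<p}. \<zero> \<otimes> x j) = \<zero>"
    using assms(3) by (intro add.finprod_one_eqI l_null) auto
  then show ?case by simp
next
  case (Suc m)
  have \<mu>: "\<mu> k \<in> carrier R" if "k < Suc m" for k using Suc.prems(1) that by auto
  have x: "x j \<in> carrier R" if "j < p" for j using assms(3) that by auto
  have L: "L k j \<in> carrier R" if "k < Suc m" "j < p" for k j using Suc.prems(2) that by auto
  have inner: "(\<Oplus>j\<in>{..<p}. L k j \<otimes> x j) \<in> carrier R" if "k < Suc m" for k
    using that L x by (intro finsum_closed) auto
  have coef: "(\<Oplus>k\<in>{..<m}. \<mu> k \<otimes> L k j) \<in> carrier R" if "j < p" for j
    using that L \<mu> by (intro finsum_closed) auto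
  have "(\<Oplus>k\<in>{..<Suc m}. \<mu> k \<otimes> (\<Oplus>j\<in>{..<p}. L k j \<otimes> x j)) =
      (\<Oplus>k\<in>{..<m}. \<mu> k \<otimes> (\<Oplus>j\<in>{..<p}. L k j \<otimes> x j)) \<oplus> \<mu> m \<otimes> (\<Oplus>j\<in>{..<p}. L m j \<otimes> x j)"
    using \<mu> inner by (intro finsum_lessThan_Suc) auto
  also have "(\<Oplus>k\<in>{..<m}. \<mu> k \<otimes> (\<Oplus>j\<in>{..<p}. L k j \<otimes> x j)) =
      (\<Oplus>j\<in>{..<p}. (\<Oplus>k\<in>{..<m}. \<mu> k \<otimes> L k j) \<otimes> x j)"
    using Suc.prems by (intro Suc.IH) auto
  also have "\<mu> m \<otimes> (\<Oplus>j\<in>{..<p}. L m j \<otimes> x j) = (\<Oplus>j\<in>{..<p}. \<mu> m \<otimes> (L m j \<otimes> x j))"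
    using \<mu> L x by (intro finsum_rdistr) auto
  also have "(\<Oplus>j\<in>{..<p}. (\<Oplus>k\<in>{..<m}. \<mu> k \<otimes> L k j) \<otimes> x j) \<oplus> \<dots> =
      (\<Oplus>j\<in>{..<p}. (\<Oplus>k\<in>{..<m}. \<mu> k \<otimes> L k j) \<otimes> x j \<oplus> \<mu> m \<otimes> (L m j \<otimes> x j))"
    using \<mu> L x coef by (intro finsum_addf[symmetric]) auto
  also have "\<dots> = (\<Oplus>j\<in>{..<p}. (\<Oplus>k\<in>{..<Suc m}. \<mu> k \<otimes> L k j) \<otimes> x j)"
  proof (rule add.finprod_cong')
    fix j assume "j \<in> {..<p}"
    then have j: "j < p" by simp
    have "(\<Oplus>k\<in>{..<Suc m}. \<mu> k \<otimes> L k j) = (\<Oplus>k\<in>{..<m}. \<mu> k \<otimes> L k j) \<oplus> \<mu> m \<otimes> L m j"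
      using \<mu> L j by (intro finsum_lessThan_Suc) auto
    then show "(\<Oplus>k\<in>{..<m}. \<mu> k \<otimes> L k j) \<otimes> x j \<oplus> \<mu> m \<otimes> (L m j \<otimes> x j) =
        (\<Oplus>k\<in>{..<Suc m}. \<mu> k \<otimes> L k j) \<otimes> x j"
      using coef[OF j] \<mu>[of m] L[of m j] x[OF j] j by (simp add: l_distr m_assoc)
  next
    have "(\<Oplus>k\<in>{..<Suc m}. \<mu> k \<otimes> L k j) \<in> carrier R" if "j < p" for j
      using that L \<mu> by (intro finsum_closed) auto
    then show "(\<lambda>j. (\<Oplus>k\<in>{..<Suc m}. \<mu> k \<otimes> L k j) \<otimes> x j) \<in> {..<p} \<rightarrow> carrier R"
      using x by auto
  qed simp
  finally show ?case .
qed

section \<open>Multilinear forms and coordinate monomials\<close>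

lemma restrict_in_vec: "(\<And>i. i < n \<Longrightarrow> f i \<in> carrier S) \<Longrightarrow> (\<lambda>i\<in>{..<n}. f i) \<in> vec S n"
  by (simp add: vec_def)

lemma vec_carrier: "w \<in> vec S n \<Longrightarrow> i < n \<Longrightarrow> w i \<in> carrier S"
  by (simp add: vec_def PiE_iff)

lemma vec_restrict: "w \<in> vec S n \<Longrightarrow> (\<lambda>i\<in>{..<n}. w i) = w"
  by (simp add: vec_def PiE_iff extensional_restrict)

definition unit_vec :: "'r ring \<Rightarrow> nat \<Rightarrow> nat \<Rightarrow> nat \<Rightarrow> 'r" where
  "unit_vec S n i = (\<lambda>j\<in>{..<n}. if j = i then \<one>\<^bsub>S\<^esub> else \<zero>\<^bsub>S\<^esub>)"

text \<open>
  Linearity in one slot, applied to \<open>w = \<Sum> w\<^sub>i e\<^sub>i\<close>.  The vector \<open>part s\<close> in the proof is the partial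
  sum of the first \<open>s\<close> terms.
\<close>

lemma multilinear_slot_vanishes:
  assumes "cring S" and \<phi>: "multilinear S n q \<phi>" "\<And>v. v \<in> {..<q} \<rightarrow>\<^sub>E vec S n \<Longrightarrow> \<phi> v \<in> carrier S"
    and v: "v \<in> {..<q} \<rightarrow>\<^sub>E vec S n" "r < q" and w: "w \<in> vec S n" and c: "c \<in> carrier S"
    and vanish: "\<And>i. i < n \<Longrightarrow> c \<otimes>\<^bsub>S\<^esub> (w i \<otimes>\<^bsub>S\<^esub> \<phi> (v(r := unit_vec S n i))) = \<zero>\<^bsub>S\<^esub>"
  shows "c \<otimes>\<^bsub>S\<^esub> \<phi> (v(r := w)) = \<zero>\<^bsub>S\<^esub>"
proof -
  interpret cring S by fact
  define \<psi> where "\<psi> u = \<phi> (v(r := u))" for u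
  define part where "part s = (\<lambda>i\<in>{..<n}. if i < s then w i else \<zero>\<^bsub>S\<^esub>)" for s
  have part: "part s \<in> vec S n" for s
    using w unfolding part_def by (intro restrict_in_vec) (simp add: vec_carrier)
  have unit: "unit_vec S n i \<in> vec S n" for i
    unfolding unit_vec_def by (intro restrict_in_vec) simp
  have \<psi>c: "\<psi> u \<in> carrier S" if "u \<in> vec S n" for u
    unfolding \<psi>_def using v that by (intro \<phi>(2)) (simp add: PiE_iff extensional_def)
  note linear = \<phi>(1)[unfolded multilinear_def, rule_format, OF v, folded \<psi>_def]
  have add: "\<psi> (vadd S n u u') = \<psi> u \<oplus>\<^bsub>S\<^esub> \<psi> u'"
    if "u \<in> vec S n" "u' \<in> vec S n" for u u'
    using linear[OF that zero_closed] by (rule conjunct1)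
  have scale: "\<psi> (vscale S n a u) = a \<otimes>\<^bsub>S\<^esub> \<psi> u"
    if "u \<in> vec S n" "a \<in> carrier S" for u a
    using linear[OF that(1) that(1) that(2)] by (rule conjunct2)
  have "c \<otimes>\<^bsub>S\<^esub> \<psi> (part s) = \<zero>\<^bsub>S\<^esub>" if "s \<le> n" for s
    using that
  proof (induction s)
    case 0
    \<comment> \<open>\<open>part 0\<close> is the zero vector, hence its own multiple by zero.\<close>
    have "vscale S n \<zero>\<^bsub>S\<^esub> (part 0) = part 0"
      unfolding part_def vscale_def by (intro ext) simp
    then have "\<psi> (part 0) = \<zero>\<^bsub>S\<^esub>"
      using scale[OF part zero_closed, of 0] l_null[OF \<psi>c[OF part, of 0]] by metis
    then show ?case using c by simp
  next
    case (Suc s)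
    have ws: "w s \<in> carrier S" using w Suc.prems by (simp add: vec_carrier)
    have sc: "vscale S n (w s) (unit_vec S n s) \<in> vec S n"
      using unit[of s] ws unfolding vscale_def by (intro restrict_in_vec) (simp add: vec_carrier)
    have "part (Suc s) = vadd S n (part s) (vscale S n (w s) (unit_vec S n s))"
    proof
      fix i
      show "part (Suc s) i = vadd S n (part s) (vscale S n (w s) (unit_vec S n s)) i"
        using ws vec_carrier[OF w, of i]
        by (auto simp: part_def vadd_def vscale_def unit_vec_def less_Suc_eq)
    qed
    then have "\<psi> (part (Suc s)) =
        \<psi> (part s) \<oplus>\<^bsub>S\<^esub> w s \<otimes>\<^bsub>S\<^esub> \<psi> (unit_vec S n s)"
      by (simp add: add[OF part sc] scale[OF unit ws])
    then show ?case
      using Suc c ws vanish[of s, folded \<psi>_def] \<psi>c[OF part, of s] \<psi>c[OF unit, of s] by (simp add: r_distr)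
  qed
  moreover have "part n = w"
    unfolding part_def by (subst vec_restrict[OF w, symmetric]) (intro restrict_ext, simp)
  ultimately show ?thesis unfolding \<psi>_def by auto
qed

text \<open>
  A multilinear form is a linear combination of coordinate monomials, so it vanishes where they all
  do.  Instead of writing out the expansion, the proof replaces one slot after the other by unit
  vectors: \<open>r\<close> counts the slots still to be expanded, and \<open>c\<close> collects the coordinates of the slots
  already expanded.  With \<open>r = 0\<close> the assumption says \<open>c = 0\<close>; the case of interest is \<open>r = q\<close> and
  \<open>c = 1\<close>.
\<close>

lemma multilinear_vanishes:
  assumes "cring S" and \<phi>: "multilinear S n q \<phi>" "\<And>v. v \<in> {..<q} \<rightarrow>\<^sub>E vec S n \<Longrightarrow> \<phi> v \<in> carrier S"
    and "v \<in> {..<q} \<rightarrow>\<^sub>E vec S n" "r \<le> q" "c \<in> carrier S"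
    and "\<And>m. m \<in> {..<r} \<rightarrow> {..<n} \<Longrightarrow> c \<otimes>\<^bsub>S\<^esub> (\<Otimes>\<^bsub>S\<^esub>l\<in>{..<r}. v l (m l)) = \<zero>\<^bsub>S\<^esub>"
  shows "c \<otimes>\<^bsub>S\<^esub> \<phi> v = \<zero>\<^bsub>S\<^esub>"
proof -
  interpret cring S by fact
  show ?thesis
    using assms(4-)
  proof (induction r arbitrary: c v)
    case 0
    then have "c = \<zero>\<^bsub>S\<^esub>" by simp
    then show ?case using \<phi>(2) 0 by simp
  next
    case (Suc r)
    note v = Suc.prems(1) and r = Suc.prems(2) and c = Suc.prems(3)
    have vr: "v r \<in> vec S n" using v r by (simp add: PiE_iff)
    have "c \<otimes>\<^bsub>S\<^esub> \<phi> (v(r := v r)) = \<zero>\<^bsub>S\<^esub>"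
    proof (rule multilinear_slot_vanishes[OF \<open>cring S\<close> \<phi> v _ vr c])
      fix i assume i: "i < n"
      define v' where "v' = v(r := unit_vec S n i)"
      have vri: "v r i \<in> carrier S" using vr i by (simp add: vec_carrier)
      have v': "v' \<in> {..<q} \<rightarrow>\<^sub>E vec S n"
        using v r restrict_in_vec[of n "\<lambda>j. if j = i then \<one>\<^bsub>S\<^esub> else \<zero>\<^bsub>S\<^esub>" S]
        by (simp add: v'_def unit_vec_def PiE_iff extensional_def)
      have "(c \<otimes>\<^bsub>S\<^esub> v r i) \<otimes>\<^bsub>S\<^esub> \<phi> v' = \<zero>\<^bsub>S\<^esub>"
      proof (rule Suc.IH[OF v'])
        fix m assume m: "m \<in> {..<r} \<rightarrow> {..<n}"
        have vm: "v l (m l) \<in> carrier S" if "l < r" for l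
        proof -
          have "v l \<in> vec S n" "m l < n" using that m v r by (auto simp: PiE_iff)
          then show ?thesis by (simp add: vec_carrier)
        qed
        then have pc: "(\<Otimes>\<^bsub>S\<^esub>l\<in>{..<r}. v l (m l)) \<in> carrier S" by (intro finprod_closed) auto
        have "m(r := i) \<in> {..<Suc r} \<rightarrow> {..<n}" using m i by (auto simp: less_Suc_eq)
        from Suc.prems(4)[OF this]
        have "c \<otimes>\<^bsub>S\<^esub> (\<Otimes>\<^bsub>S\<^esub>l\<in>{..<Suc r}. v l ((m(r := i)) l)) = \<zero>\<^bsub>S\<^esub>" .
        also have "(\<Otimes>\<^bsub>S\<^esub>l\<in>{..<Suc r}. v l ((m(r := i)) l)) =
            (\<Otimes>\<^bsub>S\<^esub>l\<in>{..<r}. v l ((m(r := i)) l)) \<otimes>\<^bsub>S\<^esub> v r i"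
          using vm vri by (subst finprod_lessThan_Suc) (auto simp: less_Suc_eq)
        also have "(\<Otimes>\<^bsub>S\<^esub>l\<in>{..<r}. v l ((m(r := i)) l)) = (\<Otimes>\<^bsub>S\<^esub>l\<in>{..<r}. v l (m l))"
          using vm by (intro finprod_cong') auto
        finally have "(c \<otimes>\<^bsub>S\<^esub> v r i) \<otimes>\<^bsub>S\<^esub> (\<Otimes>\<^bsub>S\<^esub>l\<in>{..<r}. v l (m l)) = \<zero>\<^bsub>S\<^esub>"
          using c vri pc by (simp add: m_ac)
        also have "(\<Otimes>\<^bsub>S\<^esub>l\<in>{..<r}. v l (m l)) = (\<Otimes>\<^bsub>S\<^esub>l\<in>{..<r}. v' l (m l))"
          using vm by (intro finprod_cong') (auto simp: v'_def)
        finally show "(c \<otimes>\<^bsub>S\<^esub> v r i) \<otimes>\<^bsub>S\<^esub> (\<Otimes>\<^bsub>S\<^esub>l\<in>{..<r}. v' l (m l)) = \<zero>\<^bsub>S\<^esub>" .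
      qed (use r c vri in auto)
      then show "c \<otimes>\<^bsub>S\<^esub> (v r i \<otimes>\<^bsub>S\<^esub> \<phi> (v(r := unit_vec S n i))) = \<zero>\<^bsub>S\<^esub>"
        using c vri \<phi>(2)[OF v'] by (simp add: m_assoc v'_def)
    qed (use r in auto)
    then show ?case by simp
  qed
qed

lemma multilinear_monomial:
  assumes "cring S" and m: "m \<in> {..<q} \<rightarrow> {..<n}"
  shows "multilinear S n q (\<lambda>v. \<Otimes>\<^bsub>S\<^esub>l\<in>{..<q}. v l (m l))"
proof -
  interpret cring S by fact
  have split: "(\<Otimes>\<^bsub>S\<^esub>l'\<in>{..<q}. (v(l := u)) l' (m l')) =
      u (m l) \<otimes>\<^bsub>S\<^esub> (\<Otimes>\<^bsub>S\<^esub>l'\<in>{..<q} - {l}. v l' (m l'))"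
    if v: "v \<in> {..<q} \<rightarrow>\<^sub>E vec S n" "l < q" and u: "u \<in> vec S n" for v l u
  proof -
    have vm: "v l' (m l') \<in> carrier S" if "l' < q" for l'
    proof -
      have "v l' \<in> vec S n" "m l' < n" using that m v by (auto simp: PiE_iff)
      then show ?thesis by (simp add: vec_carrier)
    qed
    have um: "u (m l) \<in> carrier S"
      using u m v(2) by (intro vec_carrier[of _ _ n]) auto
    have "(\<Otimes>\<^bsub>S\<^esub>l'\<in>{..<q}. (v(l := u)) l' (m l')) =
        (\<Otimes>\<^bsub>S\<^esub>l'\<in>insert l ({..<q} - {l}). (v(l := u)) l' (m l'))"
      using v(2) by (simp add: insert_absorb)
    also have "\<dots> = u (m l) \<otimes>\<^bsub>S\<^esub> (\<Otimes>\<^bsub>S\<^esub>l'\<in>{..<q} - {l}. (v(l := u)) l' (m l'))"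
      using vm um by (subst finprod_insert) auto
    also have "(\<Otimes>\<^bsub>S\<^esub>l'\<in>{..<q} - {l}. (v(l := u)) l' (m l')) = (\<Otimes>\<^bsub>S\<^esub>l'\<in>{..<q} - {l}. v l' (m l'))"
      using vm by (intro finprod_cong') auto
    finally show ?thesis .
  qed
  show ?thesis
    unfolding multilinear_def
  proof (intro ballI allI impI)
    fix v l u w a
    assume v: "v \<in> {..<q} \<rightarrow>\<^sub>E vec S n" and l: "l < q"
      and u: "u \<in> vec S n" and w: "w \<in> vec S n" and a: "a \<in> carrier S"
    define P where "P = (\<Otimes>\<^bsub>S\<^esub>l'\<in>{..<q} - {l}. v l' (m l'))"
    have P: "P \<in> carrier S"
      unfolding P_def
    proof (rule finprod_closed, rule funcsetI)
      fix l' assume l': "l' \<in> {..<q} - {l}"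
      have "v l' \<in> vec S n" "m l' < n" using l' m v by (auto simp: PiE_iff)
      then show "v l' (m l') \<in> carrier S" by (simp add: vec_carrier)
    qed
    have ml: "m l < n" using m l by auto
    have c: "u (m l) \<in> carrier S" "w (m l) \<in> carrier S"
      using u w ml by (simp_all add: vec_carrier)
    have "vadd S n u w \<in> vec S n" "vscale S n a u \<in> vec S n"
      using u w a unfolding vadd_def vscale_def by (auto intro!: restrict_in_vec simp: vec_carrier)
    then show "(\<Otimes>\<^bsub>S\<^esub>l'\<in>{..<q}. (v(l := vadd S n u w)) l' (m l')) =
        (\<Otimes>\<^bsub>S\<^esub>l'\<in>{..<q}. (v(l := u)) l' (m l')) \<oplus>\<^bsub>S\<^esub> (\<Otimes>\<^bsub>S\<^esub>l'\<in>{..<q}. (v(l := w)) l' (m l')) \<and>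
      (\<Otimes>\<^bsub>S\<^esub>l'\<in>{..<q}. (v(l := vscale S n a u)) l' (m l')) =
        a \<otimes>\<^bsub>S\<^esub> (\<Otimes>\<^bsub>S\<^esub>l'\<in>{..<q}. (v(l := u)) l' (m l'))"
      unfolding split[OF v l u] split[OF v l w]
      using split[OF v l] ml c a P by (simp add: P_def[symmetric] vadd_def vscale_def l_distr m_assoc)
  qed
qed


section \<open>Affine combinations of tuples with nilpotent differences\<close>

text \<open>
  The equations defining \<open>A\<^sub>k\<langle>p\<rangle>\<close>, for an ordinary ring.  In contrast to the definition of the
  higher-order i-structures, \<open>i l = j l\<close> is allowed, and so is \<open>p < 2\<close>; see \<open>kth_order_iff\<close>.
\<close>

definition nilpotent_differences :: "'r ring \<Rightarrow> nat \<Rightarrow> nat \<Rightarrow> nat \<Rightarrow> (nat \<Rightarrow> nat \<Rightarrow> 'r) \<Rightarrow> bool" where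
  "nilpotent_differences S k n p P \<longleftrightarrow>
     (\<forall>i \<in> {..<k+1} \<rightarrow> {..<p}. \<forall>j \<in> {..<k+1} \<rightarrow> {..<p}. \<forall>m \<in> {..<k+1} \<rightarrow> {..<n}.
        (\<Otimes>\<^bsub>S\<^esub>l\<in>{..<k+1}. P (i l) (m l) \<ominus>\<^bsub>S\<^esub> P (j l) (m l)) = \<zero>\<^bsub>S\<^esub>)"

lemma affine_coeffsD:
  assumes "l \<in> affine_coeffs S p"
  shows "l \<in> {..<p} \<rightarrow> carrier S" "(\<Oplus>\<^bsub>S\<^esub>j\<in>{..<p}. l j) = \<one>\<^bsub>S\<^esub>"
  using assms by (simp_all add: affine_coeffs_def PiE_def)

lemma tuple_coordinate:
  assumes "P \<in> {..<p} \<rightarrow>\<^sub>E vec S n" "j < p" "i < n"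
  shows "P j i \<in> carrier S"
proof (rule vec_carrier)
  show "P j \<in> vec S n" using assms by (simp add: PiE_iff)
qed fact

lemma tuple_coordinates:
  assumes "P \<in> {..<p} \<rightarrow>\<^sub>E vec S n" "i < n"
  shows "(\<lambda>j. P j i) \<in> {..<p} \<rightarrow> carrier S"
  using tuple_coordinate[OF assms(1) _ assms(2)] by simp

lemma affine_comb_in_vec:
  assumes "cring S" "l \<in> affine_coeffs S p" "P \<in> {..<p} \<rightarrow>\<^sub>E vec S n"
  shows "affine_comb S n p l P \<in> vec S n"
proof -
  interpret cring S by fact
  show ?thesis
    unfolding affine_comb_def
    using affine_coeffsD(1)[OF assms(2)] tuple_coordinates[OF assms(3)]
    by (intro restrict_in_vec finsum_closed) (simp add: Pi_iff)
qed

text \<open>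
  The neighbourhood axiom at a single stage.  In the proof, \<open>Y l\<close> generates the ideal containing the
  \<open>l\<close>-th factor \<open>x l\<close>, a coordinate of a difference of two affine combinations.
\<close>

lemma nilpotent_differences_affine_comb:
  assumes "cring S" and P: "P \<in> {..<p} \<rightarrow>\<^sub>E vec S n" and nil: "nilpotent_differences S k n p P"
    and L: "L \<in> {..<q} \<rightarrow> affine_coeffs S p"
  shows "nilpotent_differences S k n q (\<lambda>a\<in>{..<q}. affine_comb S n p (L a) P)"
proof -
  interpret cring S by fact
  show ?thesis
    unfolding nilpotent_differences_def
  proof (intro ballI)
    fix i j m
    assume i: "i \<in> {..<k+1} \<rightarrow> {..<q}" and j: "j \<in> {..<k+1} \<rightarrow> {..<q}"
      and m: "m \<in> {..<k+1} \<rightarrow> {..<n}"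
    define Y where "Y l = {P a (m l) \<ominus>\<^bsub>S\<^esub> P b (m l) | a b. a < p \<and> b < p}" for l
    define x where "x l = (\<lambda>a\<in>{..<q}. affine_comb S n p (L a) P) (i l) (m l) \<ominus>\<^bsub>S\<^esub>
      (\<lambda>a\<in>{..<q}. affine_comb S n p (L a) P) (j l) (m l)" for l
    have ml: "m l < n" "i l < q" "j l < q" if "l < k+1" for l using m i j that by (auto simp: Pi_iff)
    have Y: "Y l \<subseteq> carrier S" if "l < k+1" for l
      using tuple_coordinate[OF P _ ml(1)[OF that]] by (auto simp: Y_def)
    have "\<one>\<^bsub>S\<^esub> \<otimes>\<^bsub>S\<^esub> (\<Otimes>\<^bsub>S\<^esub>l\<in>{..<k+1}. x l) = \<zero>\<^bsub>S\<^esub>"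
    proof (rule prod_genideal_vanishes[where Y = Y])
      fix y assume y: "y \<in> (\<Pi> l\<in>{..<k+1}. Y l)"
      then have "\<forall>l\<in>{..<k+1}. \<exists>a b. a < p \<and> b < p \<and> y l = P a (m l) \<ominus>\<^bsub>S\<^esub> P b (m l)"
        unfolding Pi_iff Y_def by blast
      then obtain a b where ab: "\<And>l. l < k+1 \<Longrightarrow> a l < p \<and> b l < p \<and> y l = P (a l) (m l) \<ominus>\<^bsub>S\<^esub> P (b l) (m l)"
        by (metis lessThan_iff)
      have "(\<Otimes>\<^bsub>S\<^esub>l\<in>{..<k+1}. y l) = (\<Otimes>\<^bsub>S\<^esub>l\<in>{..<k+1}. P (a l) (m l) \<ominus>\<^bsub>S\<^esub> P (b l) (m l))"
        using ab tuple_coordinate[OF P _ ml(1)] by (intro finprod_cong') auto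
      also have "\<dots> = \<zero>\<^bsub>S\<^esub>"
        using nil ab m unfolding nilpotent_differences_def by (simp add: Pi_iff)
      finally show "\<one>\<^bsub>S\<^esub> \<otimes>\<^bsub>S\<^esub> (\<Otimes>\<^bsub>S\<^esub>l\<in>{..<k+1}. y l) = \<zero>\<^bsub>S\<^esub>" by simp
    next
      fix l assume l: "l < k+1"
      have La: "L (i l) \<in> affine_coeffs S p" "L (j l) \<in> affine_coeffs S p"
        using L ml[OF l] by (auto simp: Pi_iff)
      have "(\<Oplus>\<^bsub>S\<^esub>a\<in>{..<p}. L (i l) a \<otimes>\<^bsub>S\<^esub> P a (m l)) \<ominus>\<^bsub>S\<^esub>
          (\<Oplus>\<^bsub>S\<^esub>a\<in>{..<p}. L (j l) a \<otimes>\<^bsub>S\<^esub> P a (m l)) \<in> Idl\<^bsub>S\<^esub> (Y l)"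
      proof (rule affine_sum_diff_mem_ideal[OF genideal_ideal])
        show "P a (m l) \<ominus>\<^bsub>S\<^esub> P b (m l) \<in> Idl\<^bsub>S\<^esub> (Y l)" if "a < p" "b < p" for a b
          using that by (intro subsetD[OF genideal_self[OF Y[OF l]]]) (auto simp: Y_def)
      qed (use Y[OF l] affine_coeffsD[OF La(1)] affine_coeffsD[OF La(2)]
            tuple_coordinates[OF P ml(1)[OF l]] in simp_all)
      then show "x l \<in> Idl\<^bsub>S\<^esub> (Y l)"
        using ml[OF l] by (simp add: x_def affine_comb_def)
    qed (use Y in simp_all)
    moreover have "x l \<in> carrier S" if "l < k+1" for l
    proof -
      have "affine_comb S n p (L a) P (m l) \<in> carrier S" if "a < q" for a
        using that L ml(1)[OF \<open>l < k+1\<close>] P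
        by (intro vec_carrier[OF affine_comb_in_vec[OF assms(1)]]) (auto simp: Pi_iff)
      then show ?thesis using ml[OF that] by (simp add: x_def)
    qed
    then have "(\<Otimes>\<^bsub>S\<^esub>l\<in>{..<k+1}. x l) \<in> carrier S" by (intro finprod_closed) simp
    ultimately show "(\<Otimes>\<^bsub>S\<^esub>l\<in>{..<k+1}. (\<lambda>a\<in>{..<q}. affine_comb S n p (L a) P) (i l) (m l) \<ominus>\<^bsub>S\<^esub>
      (\<lambda>a\<in>{..<q}. affine_comb S n p (L a) P) (j l) (m l)) = \<zero>\<^bsub>S\<^esub>"
      unfolding x_def by simp
  qed
qed

lemma affine_comb_assoc:
  assumes "cring S" and P: "P \<in> {..<p} \<rightarrow>\<^sub>E vec S n" and L: "L \<in> {..<q} \<rightarrow> affine_coeffs S p"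
    and \<mu>: "\<mu> \<in> affine_coeffs S q"
  shows "affine_comb S n q \<mu> (\<lambda>a\<in>{..<q}. affine_comb S n p (L a) P) =
    affine_comb S n p (\<lambda>j\<in>{..<p}. \<Oplus>\<^bsub>S\<^esub>a\<in>{..<q}. \<mu> a \<otimes>\<^bsub>S\<^esub> L a j) P"
proof -
  interpret cring S by fact
  have Lc: "L a j \<in> carrier S" if "a < q" "j < p" for a j
  proof -
    have "L a \<in> affine_coeffs S p" using L that(1) by auto
    then show ?thesis using affine_coeffsD(1) that(2) by fastforce
  qed
  have \<mu>c: "\<mu> a \<in> carrier S" if "a < q" for a
    using affine_coeffsD(1)[OF \<mu>] that by auto
  have "(\<Oplus>\<^bsub>S\<^esub>a\<in>{..<q}. \<mu> a \<otimes>\<^bsub>S\<^esub> (\<lambda>a\<in>{..<q}. affine_comb S n p (L a) P) a i) =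
      (\<Oplus>\<^bsub>S\<^esub>j\<in>{..<p}. (\<lambda>j\<in>{..<p}. \<Oplus>\<^bsub>S\<^esub>a\<in>{..<q}. \<mu> a \<otimes>\<^bsub>S\<^esub> L a j) j \<otimes>\<^bsub>S\<^esub> P j i)" if i: "i < n" for i
  proof -
    have inner: "(\<Oplus>\<^bsub>S\<^esub>j\<in>{..<p}. L a j \<otimes>\<^bsub>S\<^esub> P j i) \<in> carrier S" if "a < q" for a
      using that Lc tuple_coordinate[OF P _ i] by (intro finsum_closed) auto
    have coef: "(\<Oplus>\<^bsub>S\<^esub>a\<in>{..<q}. \<mu> a \<otimes>\<^bsub>S\<^esub> L a j) \<in> carrier S" if "j < p" for j
      using that Lc \<mu>c by (intro finsum_closed) auto
    have "(\<Oplus>\<^bsub>S\<^esub>a\<in>{..<q}. \<mu> a \<otimes>\<^bsub>S\<^esub> (\<lambda>a\<in>{..<q}. affine_comb S n p (L a) P) a i) =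
        (\<Oplus>\<^bsub>S\<^esub>a\<in>{..<q}. \<mu> a \<otimes>\<^bsub>S\<^esub> (\<Oplus>\<^bsub>S\<^esub>j\<in>{..<p}. L a j \<otimes>\<^bsub>S\<^esub> P j i))"
      using i inner \<mu>c by (intro add.finprod_cong') (auto simp: affine_comb_def)
    also have "\<dots> = (\<Oplus>\<^bsub>S\<^esub>j\<in>{..<p}. (\<Oplus>\<^bsub>S\<^esub>a\<in>{..<q}. \<mu> a \<otimes>\<^bsub>S\<^esub> L a j) \<otimes>\<^bsub>S\<^esub> P j i)"
      using Lc \<mu>c tuple_coordinates[OF P i] by (intro finsum_nested) auto
    also have "\<dots> = (\<Oplus>\<^bsub>S\<^esub>j\<in>{..<p}. (\<lambda>j\<in>{..<p}. \<Oplus>\<^bsub>S\<^esub>a\<in>{..<q}. \<mu> a \<otimes>\<^bsub>S\<^esub> L a j) j \<otimes>\<^bsub>S\<^esub> P j i)"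
      using coef tuple_coordinate[OF P _ i] by (intro add.finprod_cong') auto
    finally show ?thesis .
  qed
  then show ?thesis
    unfolding affine_comb_def[of S n q] affine_comb_def[of S n p "\<lambda>j\<in>{..<p}. _ j"]
    by (intro restrict_ext) simp
qed

lemma affine_comb_proj:
  assumes "cring S" and P: "P \<in> {..<p} \<rightarrow>\<^sub>E vec S n" and k: "k < p"
  shows "affine_comb S n p (\<lambda>j\<in>{..<p}. if j = k then \<one>\<^bsub>S\<^esub> else \<zero>\<^bsub>S\<^esub>) P = P k"
proof -
  interpret cring S by fact
  have Pk: "P k \<in> vec S n" using P k by (simp add: PiE_iff)
  have "(\<Oplus>\<^bsub>S\<^esub>j\<in>{..<p}. (\<lambda>j\<in>{..<p}. if j = k then \<one>\<^bsub>S\<^esub> else \<zero>\<^bsub>S\<^esub>) j \<otimes>\<^bsub>S\<^esub> P j i) = P k i" if i: "i < n" for i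
  proof -
    have "(\<Oplus>\<^bsub>S\<^esub>j\<in>{..<p}. (\<lambda>j\<in>{..<p}. if j = k then \<one>\<^bsub>S\<^esub> else \<zero>\<^bsub>S\<^esub>) j \<otimes>\<^bsub>S\<^esub> P j i) =
        (\<Oplus>\<^bsub>S\<^esub>j\<in>{..<p}. if k = j then P j i else \<zero>\<^bsub>S\<^esub>)"
      using tuple_coordinate[OF P _ i] by (intro add.finprod_cong') auto
    also have "\<dots> = P k i"
      using k tuple_coordinates[OF P i] by (intro add.finprod_singleton) auto
    finally show ?thesis .
  qed
  then have "affine_comb S n p (\<lambda>j\<in>{..<p}. if j = k then \<one>\<^bsub>S\<^esub> else \<zero>\<^bsub>S\<^esub>) P = (\<lambda>i\<in>{..<n}. P k i)"
    unfolding affine_comb_def by (intro restrict_ext) simp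
  also have "\<dots> = P k" by (rule vec_restrict[OF Pk])
  finally show ?thesis .
qed


section \<open>The stagewise description of the higher-order i-structures\<close>

locale algebra_object =
  fixes C :: "('o, 'm) cat" and R :: "('o, 'm, 'r) ring_object"
  assumes category: "small_category C" and algebra: "rational_algebra C R"
begin

lemma arrow_objects:
  assumes "f \<in> arrows C d c"
  shows "d \<in> Ob C" "c \<in> Ob C"
  using category assms unfolding small_category_def arrows_def by auto

lemma ident_arrow: "c \<in> Ob C \<Longrightarrow> Ident C c \<in> arrows C c c"
  using category unfolding small_category_def by blast

lemma comp_arrow: "f \<in> arrows C a b \<Longrightarrow> g \<in> arrows C b c \<Longrightarrow> Comp C g f \<in> arrows C a c"
  using category unfolding small_category_def by blast

lemma arrow_Dom: "f \<in> arrows C d c \<Longrightarrow> Dom C f = d"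
  by (simp add: arrows_def)

lemma cring_at: "c \<in> Ob C \<Longrightarrow> cring (ring_at R c)"
  using algebra unfolding rational_algebra_def by blast

lemma rst_hom:
  assumes "f \<in> arrows C d c"
  shows "ring_hom_cring (ring_at R c) (ring_at R d) (ring_rst R f)"
  using algebra assms arrow_objects[OF assms] unfolding rational_algebra_def
  by (intro ring_hom_cring.intro ring_hom_cring_axioms.intro) blast+

lemma line_space: "is_space C (line R)"
  using algebra unfolding rational_algebra_def by blast

lemma power_is_space:
  assumes "is_space C X"
  shows "is_space C (power_space X p)"
proof -
  have 1: "rst X f x \<in> pts X d" if "f \<in> arrows C d c" "x \<in> pts X c" for d c f x
    using assms that unfolding is_space_def by blast
  have 2: "rst X (Ident C c) x = x" if "c \<in> Ob C" "x \<in> pts X c" for c x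
    using assms that unfolding is_space_def by blast
  have 3: "rst X (Comp C f g) x = rst X g (rst X f x)"
    if "g \<in> arrows C e d" "f \<in> arrows C d c" "x \<in> pts X c" for e d c f g x
    using assms that unfolding is_space_def by blast
  show ?thesis
    unfolding is_space_def
  proof (intro conjI allI ballI impI)
    fix d c f P assume "f \<in> arrows C d c" "P \<in> pts (power_space X p) c"
    then show "rst (power_space X p) f P \<in> pts (power_space X p) d"
      by (simp add: power_space_def PiE_iff 1)
  next
    fix c P assume c: "c \<in> Ob C" and P: "P \<in> pts (power_space X p) c"
    show "rst (power_space X p) (Ident C c) P = P"
      using P 2[OF c] by (auto simp: power_space_def PiE_iff extensional_def)
  next
    fix e d c f g P
    assume "g \<in> arrows C e d" "f \<in> arrows C d c" "P \<in> pts (power_space X p) c"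
    then show "rst (power_space X p) (Comp C f g) P =
        rst (power_space X p) g (rst (power_space X p) f P)"
      by (auto simp: power_space_def PiE_iff 3)
  qed
qed

lemma Rn_space: "is_space C (Rn R n)"
  unfolding Rn_def by (rule power_is_space[OF line_space])

lemma pts_Rn: "pts (Rn R n) c = vec (ring_at R c) n"
  by (simp add: Rn_def power_space_def line_def vec_def)

lemma rst_Rn: "rst (Rn R n) f x = (\<lambda>i\<in>{..<n}. ring_rst R f (x i))"
  by (simp add: Rn_def power_space_def line_def)

lemma pts_power_Rn: "pts (power_space (Rn R n) p) c = {..<p} \<rightarrow>\<^sub>E vec (ring_at R c) n"
  by (simp add: power_space_def pts_Rn)

lemma rst_power_Rn:
  "rst (power_space (Rn R n) p) f P = (\<lambda>j\<in>{..<p}. \<lambda>i\<in>{..<n}. ring_rst R f (P j i))"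
  by (simp add: power_space_def rst_Rn)

lemma rst_power_Rn_closed:
  assumes "f \<in> arrows C d c" "P \<in> {..<p} \<rightarrow>\<^sub>E vec (ring_at R c) n"
  shows "rst (power_space (Rn R n) p) f P \<in> {..<p} \<rightarrow>\<^sub>E vec (ring_at R d) n"
proof -
  have "is_space C (power_space (Rn R n) p)" by (rule power_is_space[OF Rn_space])
  then show ?thesis using assms unfolding is_space_def pts_power_Rn by blast
qed

text \<open>
  As a point of the exponential, a coordinate monomial needs a component for every arrow into the
  stage \<open>c\<close>: it is the monomial over the ring at the domain of that arrow, and naturality holds since
  restrictions are ring homomorphisms.
\<close>

lemma monomial_map:
  assumes c: "c \<in> Ob C" and m: "m \<in> {..<q} \<rightarrow> {..<n}"
  shows "(\<lambda>f v. \<Otimes>\<^bsub>ring_at R (Dom C f)\<^esub>l\<in>{..<q}. v l (m l)) \<in> multilinear_maps_at C R n q c"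
proof -
  have coord: "(\<lambda>l. v l (m l)) \<in> {..<q} \<rightarrow> carrier (ring_at R d)"
    if "v \<in> {..<q} \<rightarrow>\<^sub>E vec (ring_at R d) n" for v d
    using m by (intro funcsetI tuple_coordinate[OF that]) auto
  show ?thesis
    unfolding multilinear_maps_at_def maps_at_def pts_power_Rn
  proof (intro CollectI conjI allI impI)
    fix d f v assume f: "f \<in> arrows C d c" and v: "v \<in> {..<q} \<rightarrow>\<^sub>E vec (ring_at R d) n"
    interpret cring "ring_at R d" using arrow_objects[OF f] by (intro cring_at)
    show "(\<Otimes>\<^bsub>ring_at R (Dom C f)\<^esub>l\<in>{..<q}. v l (m l)) \<in> pts (line R) d"
      using finprod_closed[OF coord[OF v]] by (simp add: arrow_Dom[OF f] line_def)
  next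
    fix e d f g v
    assume g: "g \<in> arrows C e d" and f: "f \<in> arrows C d c"
      and v: "v \<in> {..<q} \<rightarrow>\<^sub>E vec (ring_at R d) n"
    interpret h: ring_hom_cring "ring_at R d" "ring_at R e" "ring_rst R g" by (rule rst_hom[OF g])
    have "ring_rst R g (\<Otimes>\<^bsub>ring_at R d\<^esub>l\<in>{..<q}. v l (m l)) =
        (\<Otimes>\<^bsub>ring_at R e\<^esub>l\<in>{..<q}. ring_rst R g (v l (m l)))"
      using h.hom_finprod[OF coord[OF v]] by (simp add: comp_def)
    also have "\<dots> = (\<Otimes>\<^bsub>ring_at R e\<^esub>l\<in>{..<q}. rst (power_space (Rn R n) q) g v l (m l))"
      using coord[OF v] m by (intro h.S.finprod_cong') (auto simp: rst_power_Rn Pi_iff)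
    finally show "rst (line R) g (\<Otimes>\<^bsub>ring_at R (Dom C f)\<^esub>l\<in>{..<q}. v l (m l)) =
        (\<Otimes>\<^bsub>ring_at R (Dom C (Comp C f g))\<^esub>l\<in>{..<q}. rst (power_space (Rn R n) q) g v l (m l))"
      by (simp add: arrow_Dom[OF f] arrow_Dom[OF comp_arrow[OF g f]] line_def)
  next
    fix d f assume f: "f \<in> arrows C d c"
    show "multilinear (ring_at R d) n q (\<lambda>v. \<Otimes>\<^bsub>ring_at R (Dom C f)\<^esub>l\<in>{..<q}. v l (m l))"
      unfolding arrow_Dom[OF f]
      by (rule multilinear_monomial[OF cring_at[OF arrow_objects(1)[OF f]] m])
  qed
qed

lemma D_subset_vec: "pts (D R k n) c \<subseteq> vec (ring_at R c) n"
  unfolding D_def by (simp add: pts_Rn)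

text \<open>
  The quantifier over all later stages and all multilinear maps there reduces to finitely many
  equations at the present stage.  These equations follow by testing with the monomials at the
  identity arrow; conversely they persist to later stages and kill every multilinear form there.
\<close>

lemma DN_iff:
  assumes c: "c \<in> Ob C"
  shows "v \<in> DN C R k n c \<longleftrightarrow> v \<in> {..<k+1} \<rightarrow>\<^sub>E pts (D R k n) c \<and>
    (\<forall>m \<in> {..<k+1} \<rightarrow> {..<n}. (\<Otimes>\<^bsub>ring_at R c\<^esub>l\<in>{..<k+1}. v l (m l)) = \<zero>\<^bsub>ring_at R c\<^esub>)"
    (is "_ \<longleftrightarrow> ?V \<and> ?M")
proof
  assume v: "v \<in> DN C R k n c"
  then have V: ?V unfolding DN_def by blast
  then have vv: "v \<in> {..<k+1} \<rightarrow>\<^sub>E vec (ring_at R c) n" using PiE_mono[of "{..<k+1}" "\<lambda>_. pts (D R k n) c", OF D_subset_vec] by blast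
  have id: "rst (power_space (Rn R n) (k+1)) (Ident C c) v = v"
    using power_is_space[OF Rn_space, of n "k+1"] c vv unfolding is_space_def pts_power_Rn by blast
  have ?M
  proof
    fix m assume m: "m \<in> {..<k+1} \<rightarrow> {..<n}"
    have "\<forall>\<phi>\<in>multilinear_maps_at C R n (k+1) c.
        \<phi> (Ident C c) (rst (power_space (Rn R n) (k+1)) (Ident C c) v) = \<zero>\<^bsub>ring_at R c\<^esub>"
      using v ident_arrow[OF c] unfolding DN_def by blast
    from this[rule_format, OF monomial_map[OF c m]]
    have "(\<Otimes>\<^bsub>ring_at R (Dom C (Ident C c))\<^esub>l\<in>{..<k+1}.
        rst (power_space (Rn R n) (k+1)) (Ident C c) v l (m l)) = \<zero>\<^bsub>ring_at R c\<^esub>" .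
    then show "(\<Otimes>\<^bsub>ring_at R c\<^esub>l\<in>{..<k+1}. v l (m l)) = \<zero>\<^bsub>ring_at R c\<^esub>"
      unfolding id arrow_Dom[OF ident_arrow[OF c]] .
  qed
  with V show "?V \<and> ?M" ..
next
  assume VM: "?V \<and> ?M"
  then have v: "v \<in> {..<k+1} \<rightarrow>\<^sub>E vec (ring_at R c) n" using PiE_mono[of "{..<k+1}" "\<lambda>_. pts (D R k n) c", OF D_subset_vec] by blast
  have "\<phi> (Ident C d) (rst (power_space (Rn R n) (k+1)) f v) = \<zero>\<^bsub>ring_at R d\<^esub>"
    if f: "f \<in> arrows C d c" and \<phi>: "\<phi> \<in> multilinear_maps_at C R n (k+1) d" for d f \<phi>
  proof -
    interpret h: ring_hom_cring "ring_at R c" "ring_at R d" "ring_rst R f" by (rule rst_hom[OF f])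
    define w where "w = rst (power_space (Rn R n) (k+1)) f v"
    have w: "w \<in> {..<k+1} \<rightarrow>\<^sub>E vec (ring_at R d) n"
      unfolding w_def by (rule rst_power_Rn_closed[OF f v])
    have id: "Ident C d \<in> arrows C d d" by (rule ident_arrow[OF arrow_objects(1)[OF f]])
    have ml: "multilinear (ring_at R d) n (k+1) (\<phi> (Ident C d))"
      using \<phi> id unfolding multilinear_maps_at_def by blast
    have cl: "\<phi> (Ident C d) u \<in> carrier (ring_at R d)" if "u \<in> {..<k+1} \<rightarrow>\<^sub>E vec (ring_at R d) n" for u
    proof -
      have "\<phi> (Ident C d) u \<in> pts (line R) d"
        using \<phi> id that unfolding multilinear_maps_at_def maps_at_def pts_power_Rn by blast
      then show ?thesis by (simp add: line_def)
    qed
    have "\<one>\<^bsub>ring_at R d\<^esub> \<otimes>\<^bsub>ring_at R d\<^esub> \<phi> (Ident C d) w = \<zero>\<^bsub>ring_at R d\<^esub>"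
    proof (rule multilinear_vanishes[OF h.S.is_cring ml cl w order.refl])
      fix m assume m: "m \<in> {..<k+1} \<rightarrow> {..<n}"
      have coord: "(\<lambda>l. v l (m l)) \<in> {..<k+1} \<rightarrow> carrier (ring_at R c)"
        using m by (intro funcsetI tuple_coordinate[OF v]) auto
      have "(\<Otimes>\<^bsub>ring_at R d\<^esub>l\<in>{..<k+1}. w l (m l)) = (\<Otimes>\<^bsub>ring_at R d\<^esub>l\<in>{..<k+1}. ring_rst R f (v l (m l)))"
        using coord m by (intro h.S.finprod_cong') (auto simp: w_def rst_power_Rn Pi_iff)
      also have "\<dots> = ring_rst R f (\<Otimes>\<^bsub>ring_at R c\<^esub>l\<in>{..<k+1}. v l (m l))"
        using h.hom_finprod[OF coord] by (simp add: comp_def)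
      also have "\<dots> = \<zero>\<^bsub>ring_at R d\<^esub>" using VM m by simp
      finally show "\<one>\<^bsub>ring_at R d\<^esub> \<otimes>\<^bsub>ring_at R d\<^esub> (\<Otimes>\<^bsub>ring_at R d\<^esub>l\<in>{..<k+1}. w l (m l)) = \<zero>\<^bsub>ring_at R d\<^esub>"
        by simp
    qed auto
    then show ?thesis using cl[OF w] by (simp add: w_def)
  qed
  with VM show "v \<in> DN C R k n c" unfolding DN_def by blast
qed

text \<open>
  By \<open>DN_iff\<close> the multilinear condition is an instance of the equations on the right.  Membership of a
  difference \<open>P\<^sub>a - P\<^sub>b\<close> in \<open>D\<^sub>k(n)\<close> is the instance where \<open>i\<close> and \<open>j\<close> are constant.  In the other
  direction, products over index families that agree somewhere contain a factor zero.
\<close>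

lemma kth_order_iff:
  assumes c: "c \<in> Ob C"
  shows "P \<in> kth_order C R k n p c \<longleftrightarrow>
    P \<in> {..<p} \<rightarrow>\<^sub>E vec (ring_at R c) n \<and> nilpotent_differences (ring_at R c) k n p P"
proof (cases "P \<in> {..<p} \<rightarrow>\<^sub>E vec (ring_at R c) n")
  case False
  then show ?thesis by (auto simp: kth_order_def pts_power_Rn split: if_splits)
next
  case P: True
  interpret cring "ring_at R c" by (rule cring_at[OF c])
  note carr = tuple_coordinate[OF P]
  have diag: "(\<Otimes>\<^bsub>ring_at R c\<^esub>l\<in>{..<k+1}. P (i l) (m l) \<ominus>\<^bsub>ring_at R c\<^esub> P (j l) (m l)) = \<zero>\<^bsub>ring_at R c\<^esub>"
    if "i \<in> {..<k+1} \<rightarrow> {..<p}" "j \<in> {..<k+1} \<rightarrow> {..<p}" "m \<in> {..<k+1} \<rightarrow> {..<n}"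
      and l: "l < k+1" "i l = j l" for i j m l
  proof (rule finprod_lessThan_eq_zero[OF _ l(1)])
    show "(\<lambda>l. P (i l) (m l) \<ominus>\<^bsub>ring_at R c\<^esub> P (j l) (m l)) \<in> {..<k+1} \<rightarrow> carrier (ring_at R c)"
      using that carr by (simp add: Pi_iff)
    have "P (j l) (m l) \<in> carrier (ring_at R c)" using that by (intro carr) (auto simp: Pi_iff)
    then show "P (i l) (m l) \<ominus>\<^bsub>ring_at R c\<^esub> P (j l) (m l) = \<zero>\<^bsub>ring_at R c\<^esub>"
      using l(2) by (simp add: minus_eq r_neg)
  qed
  have entry: "(\<Otimes>\<^bsub>ring_at R c\<^esub>l\<in>{..<k+1}. vdiff (ring_at R c) n (P (i l)) (P (j l)) (m l)) =
      (\<Otimes>\<^bsub>ring_at R c\<^esub>l\<in>{..<k+1}. P (i l) (m l) \<ominus>\<^bsub>ring_at R c\<^esub> P (j l) (m l))"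
    if "i \<in> {..<k+1} \<rightarrow> {..<p}" "j \<in> {..<k+1} \<rightarrow> {..<p}" "m \<in> {..<k+1} \<rightarrow> {..<n}" for i j m
    using that carr by (intro finprod_cong') (auto simp: vdiff_def Pi_iff)
  have restr: "(\<Otimes>\<^bsub>ring_at R c\<^esub>l\<in>{..<k+1}. (\<lambda>l\<in>{..<k+1}. vdiff (ring_at R c) n (P (i l)) (P (j l))) l (m l)) =
      (\<Otimes>\<^bsub>ring_at R c\<^esub>l\<in>{..<k+1}. vdiff (ring_at R c) n (P (i l)) (P (j l)) (m l))"
    if "i \<in> {..<k+1} \<rightarrow> {..<p}" "j \<in> {..<k+1} \<rightarrow> {..<p}" "m \<in> {..<k+1} \<rightarrow> {..<n}" for i j m
    using that carr by (intro finprod_cong') (auto simp: vdiff_def Pi_iff)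
  have "P \<in> kth_order C R k n p c \<longleftrightarrow> nilpotent_differences (ring_at R c) k n p P"
  proof
    assume K: "P \<in> kth_order C R k n p c"
    show "nilpotent_differences (ring_at R c) k n p P"
      unfolding nilpotent_differences_def
    proof (intro ballI)
      fix i j m
      assume ijm: "i \<in> {..<k+1} \<rightarrow> {..<p}" "j \<in> {..<k+1} \<rightarrow> {..<p}" "m \<in> {..<k+1} \<rightarrow> {..<n}"
      show "(\<Otimes>\<^bsub>ring_at R c\<^esub>l\<in>{..<k+1}. P (i l) (m l) \<ominus>\<^bsub>ring_at R c\<^esub> P (j l) (m l)) = \<zero>\<^bsub>ring_at R c\<^esub>"
      proof (cases "\<exists>l<k+1. i l = j l")
        case True
        then show ?thesis using diag[OF ijm] by blast
      next
        case False
        \<comment> \<open>Two distinct indices exist, so the clause for at least two points is in force.\<close>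
        have "i 0 < p" "j 0 < p" using ijm by auto
        moreover have "i 0 \<noteq> j 0" using False by simp
        ultimately have "\<not> p < 2" by linarith
        then have "(\<lambda>l\<in>{..<k+1}. vdiff (ring_at R c) n (P (i l)) (P (j l))) \<in> DN C R k n c"
          using K ijm False unfolding kth_order_def by auto
        then have "(\<Otimes>\<^bsub>ring_at R c\<^esub>l\<in>{..<k+1}.
            (\<lambda>l\<in>{..<k+1}. vdiff (ring_at R c) n (P (i l)) (P (j l))) l (m l)) = \<zero>\<^bsub>ring_at R c\<^esub>"
          using ijm(3) unfolding DN_iff[OF c] by blast
        then show ?thesis using restr[OF ijm] entry[OF ijm] by simp
      qed
    qed
  next
    assume nil: "nilpotent_differences (ring_at R c) k n p P"
    have prod0: "(\<Otimes>\<^bsub>ring_at R c\<^esub>l\<in>{..<k+1}. vdiff (ring_at R c) n (P (i l)) (P (j l)) (m l)) = \<zero>\<^bsub>ring_at R c\<^esub>"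
      if "i \<in> {..<k+1} \<rightarrow> {..<p}" "j \<in> {..<k+1} \<rightarrow> {..<p}" "m \<in> {..<k+1} \<rightarrow> {..<n}" for i j m
      using nil that unfolding entry[OF that] nilpotent_differences_def by blast
    have "(\<lambda>l\<in>{..<k+1}. vdiff (ring_at R c) n (P (i l)) (P (j l))) \<in> DN C R k n c"
      if ij: "i \<in> {..<k+1} \<rightarrow> {..<p}" "j \<in> {..<k+1} \<rightarrow> {..<p}" for i j
      unfolding DN_iff[OF c]
    proof (intro conjI ballI)
      have "vdiff (ring_at R c) n (P a) (P b) \<in> pts (D R k n) c" if "a < p" "b < p" for a b
      proof -
        have "vdiff (ring_at R c) n (P a) (P b) \<in> vec (ring_at R c) n"
          unfolding vdiff_def using that carr by (intro restrict_in_vec) simp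
        moreover have "(\<Otimes>\<^bsub>ring_at R c\<^esub>l\<in>{..<k+1}. vdiff (ring_at R c) n (P a) (P b) (m l)) = \<zero>\<^bsub>ring_at R c\<^esub>"
          if "m \<in> {..<k+1} \<rightarrow> {..<n}" for m
          using prod0[of "\<lambda>_. a" "\<lambda>_. b" m] \<open>a < p\<close> \<open>b < p\<close> that by simp
        ultimately show ?thesis by (simp add: D_def pts_Rn)
      qed
      then show "(\<lambda>l\<in>{..<k+1}. vdiff (ring_at R c) n (P (i l)) (P (j l))) \<in> {..<k+1} \<rightarrow>\<^sub>E pts (D R k n) c"
        using ij by (simp add: Pi_iff)
    next
      fix m assume m: "m \<in> {..<k+1} \<rightarrow> {..<n}"
      show "(\<Otimes>\<^bsub>ring_at R c\<^esub>l\<in>{..<k+1}.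
          (\<lambda>l\<in>{..<k+1}. vdiff (ring_at R c) n (P (i l)) (P (j l))) l (m l)) = \<zero>\<^bsub>ring_at R c\<^esub>"
        unfolding restr[OF ij m] by (rule prod0[OF ij m])
    qed
    then show "P \<in> kth_order C R k n p c"
      using P by (simp add: kth_order_def pts_power_Rn)
  qed
  with P show ?thesis by simp
qed

lemma nilpotent_differences_rst:
  assumes f: "f \<in> arrows C d c" and P: "P \<in> {..<p} \<rightarrow>\<^sub>E vec (ring_at R c) n"
    and nil: "nilpotent_differences (ring_at R c) k n p P"
  shows "nilpotent_differences (ring_at R d) k n p (rst (power_space (Rn R n) p) f P)"
  unfolding nilpotent_differences_def
proof (intro ballI)
  fix i j m
  assume ijm: "i \<in> {..<k+1} \<rightarrow> {..<p}" "j \<in> {..<k+1} \<rightarrow> {..<p}" "m \<in> {..<k+1} \<rightarrow> {..<n}"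
  interpret h: ring_hom_cring "ring_at R c" "ring_at R d" "ring_rst R f" by (rule rst_hom[OF f])
  note carr = tuple_coordinate[OF P]
  have coord: "(\<lambda>l. P (i l) (m l) \<ominus>\<^bsub>ring_at R c\<^esub> P (j l) (m l)) \<in> {..<k+1} \<rightarrow> carrier (ring_at R c)"
    using ijm carr by (simp add: Pi_iff)
  have hom: "ring_rst R f (x \<ominus>\<^bsub>ring_at R c\<^esub> y) = ring_rst R f x \<ominus>\<^bsub>ring_at R d\<^esub> ring_rst R f y"
    if "x \<in> carrier (ring_at R c)" "y \<in> carrier (ring_at R c)" for x y
    using that by (simp add: a_minus_def)
  have "(\<Otimes>\<^bsub>ring_at R d\<^esub>l\<in>{..<k+1}. rst (power_space (Rn R n) p) f P (i l) (m l)
        \<ominus>\<^bsub>ring_at R d\<^esub> rst (power_space (Rn R n) p) f P (j l) (m l)) =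
      (\<Otimes>\<^bsub>ring_at R d\<^esub>l\<in>{..<k+1}. ring_rst R f (P (i l) (m l) \<ominus>\<^bsub>ring_at R c\<^esub> P (j l) (m l)))"
    using ijm carr by (intro h.S.finprod_cong') (auto simp: rst_power_Rn Pi_iff hom)
  also have "\<dots> = ring_rst R f (\<Otimes>\<^bsub>ring_at R c\<^esub>l\<in>{..<k+1}. P (i l) (m l) \<ominus>\<^bsub>ring_at R c\<^esub> P (j l) (m l))"
    using h.hom_finprod[OF coord] by (simp add: comp_def)
  also have "\<dots> = \<zero>\<^bsub>ring_at R d\<^esub>"
    using nil ijm unfolding nilpotent_differences_def by simp
  finally show "(\<Otimes>\<^bsub>ring_at R d\<^esub>l\<in>{..<k+1}. rst (power_space (Rn R n) p) f P (i l) (m l)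
        \<ominus>\<^bsub>ring_at R d\<^esub> rst (power_space (Rn R n) p) f P (j l) (m l)) = \<zero>\<^bsub>ring_at R d\<^esub>" .
qed

lemma kth_order_i_structure: "i_structure C (Rn R n) (kth_order C R k n)"
  unfolding i_structure_def
proof (intro conjI allI ballI)
  fix p
  show "is_subspace C (power_space (Rn R n) p) (kth_order C R k n p)"
    unfolding is_subspace_def
  proof (intro conjI ballI allI impI)
    fix c assume "c \<in> Ob C"
    then show "kth_order C R k n p c \<subseteq> pts (power_space (Rn R n) p) c"
      by (auto simp: kth_order_iff pts_power_Rn)
  next
    fix d c f P assume f: "f \<in> arrows C d c" and P: "P \<in> kth_order C R k n p c"
    then show "rst (power_space (Rn R n) p) f P \<in> kth_order C R k n p d"
      using arrow_objects[OF f] rst_power_Rn_closed[OF f] nilpotent_differences_rst[OF f]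
      by (simp add: kth_order_iff)
  qed
next
  fix c
  show "kth_order C R k n 1 c = pts (power_space (Rn R n) 1) c"
    "kth_order C R k n 0 c = pts (power_space (Rn R n) 0) c"
    by (simp_all add: kth_order_def)
next
  fix q p h P and c :: 'o
  assume h: "h \<in> {..<q::nat} \<rightarrow> {..<p::nat}" and c: "c \<in> Ob C" and P: "P \<in> kth_order C R k n p c"
  have "nilpotent_differences (ring_at R c) k n q (\<lambda>i\<in>{..<q}. P (h i))"
    unfolding nilpotent_differences_def
  proof (intro ballI)
    fix i j m
    assume i: "i \<in> {..<k+1} \<rightarrow> {..<q}" and j: "j \<in> {..<k+1} \<rightarrow> {..<q}"
      and m: "m \<in> {..<k+1} \<rightarrow> {..<n}"
    interpret cring "ring_at R c" by (rule cring_at[OF c])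
    have hij: "(\<lambda>l. h (i l)) \<in> {..<k+1} \<rightarrow> {..<p}" "(\<lambda>l. h (j l)) \<in> {..<k+1} \<rightarrow> {..<p}"
      using h i j by (auto simp: Pi_iff)
    have "P \<in> {..<p} \<rightarrow>\<^sub>E vec (ring_at R c) n" using P c by (simp add: kth_order_iff)
    note carr = tuple_coordinate[OF this]
    have "(\<Otimes>\<^bsub>ring_at R c\<^esub>l\<in>{..<k+1}. (\<lambda>i\<in>{..<q}. P (h i)) (i l) (m l)
          \<ominus>\<^bsub>ring_at R c\<^esub> (\<lambda>i\<in>{..<q}. P (h i)) (j l) (m l)) =
        (\<Otimes>\<^bsub>ring_at R c\<^esub>l\<in>{..<k+1}. P (h (i l)) (m l) \<ominus>\<^bsub>ring_at R c\<^esub> P (h (j l)) (m l))"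
      using i j m hij carr by (intro finprod_cong') (auto simp: Pi_iff)
    also have "\<dots> = \<zero>\<^bsub>ring_at R c\<^esub>"
      using P c hij m by (simp add: kth_order_iff nilpotent_differences_def)
    finally show "(\<Otimes>\<^bsub>ring_at R c\<^esub>l\<in>{..<k+1}. (\<lambda>i\<in>{..<q}. P (h i)) (i l) (m l)
          \<ominus>\<^bsub>ring_at R c\<^esub> (\<lambda>i\<in>{..<q}. P (h i)) (j l) (m l)) = \<zero>\<^bsub>ring_at R c\<^esub>" .
  qed
  moreover have "(\<lambda>i\<in>{..<q}. P (h i)) \<in> {..<q} \<rightarrow>\<^sub>E vec (ring_at R c) n"
    using P h c by (simp add: kth_order_iff PiE_iff Pi_iff)
  ultimately show "(\<lambda>i\<in>{..<q}. P (h i)) \<in> kth_order C R k n q c"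
    by (simp add: kth_order_iff[OF c])
qed

lemma indiscrete_i_structure:
  assumes "is_space C X"
  shows "i_structure C X (indiscrete X)"
  using power_is_space[OF assms]
  unfolding i_structure_def is_subspace_def indiscrete_def is_space_def
  by (auto simp: power_space_def PiE_iff Pi_iff)


section \<open>Affine combinations on the affine space over the line\<close>

lemma affine_comb_natural:
  assumes f: "f \<in> arrows C d c" and l: "l \<in> affine_coeffs (ring_at R c) p"
    and P: "P \<in> {..<p} \<rightarrow>\<^sub>E vec (ring_at R c) n"
  shows "rst (Rn R n) f (affine_comb (ring_at R c) n p l P) =
    affine_comb (ring_at R d) n p (rst (power_space (line R) p) f l) (rst (power_space (Rn R n) p) f P)"
proof -
  interpret h: ring_hom_cring "ring_at R c" "ring_at R d" "ring_rst R f" by (rule rst_hom[OF f])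
  have lc: "l j \<in> carrier (ring_at R c)" if "j < p" for j
    using affine_coeffsD(1)[OF l] that by auto
  have "ring_rst R f (\<Oplus>\<^bsub>ring_at R c\<^esub>j\<in>{..<p}. l j \<otimes>\<^bsub>ring_at R c\<^esub> P j i) =
      (\<Oplus>\<^bsub>ring_at R d\<^esub>j\<in>{..<p}. rst (power_space (line R) p) f l j
        \<otimes>\<^bsub>ring_at R d\<^esub> rst (power_space (Rn R n) p) f P j i)" if i: "i < n" for i
  proof -
    note Pc = tuple_coordinate[OF P _ i]
    have "(\<lambda>j. l j \<otimes>\<^bsub>ring_at R c\<^esub> P j i) \<in> {..<p} \<rightarrow> carrier (ring_at R c)"
      using lc Pc by simp
    from h.hom_finsum[OF this]
    have "ring_rst R f (\<Oplus>\<^bsub>ring_at R c\<^esub>j\<in>{..<p}. l j \<otimes>\<^bsub>ring_at R c\<^esub> P j i) =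
        (\<Oplus>\<^bsub>ring_at R d\<^esub>j\<in>{..<p}. ring_rst R f (l j \<otimes>\<^bsub>ring_at R c\<^esub> P j i))"
      by (simp add: comp_def)
    also have "\<dots> = (\<Oplus>\<^bsub>ring_at R d\<^esub>j\<in>{..<p}. rst (power_space (line R) p) f l j
        \<otimes>\<^bsub>ring_at R d\<^esub> rst (power_space (Rn R n) p) f P j i)"
      using lc Pc i
      by (intro h.S.add.finprod_cong') (auto simp: rst_power_Rn, auto simp: power_space_def line_def)
    finally show ?thesis .
  qed
  then show ?thesis
    unfolding rst_Rn affine_comb_def by (intro restrict_ext) simp
qed

lemma affine_Rn_simps:
  "pts (affine_Rn R n T) = pts (Rn R n)" "rst (affine_Rn R n T) = rst (Rn R n)"
  "tuples (affine_Rn R n T) = T"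
  "comb (affine_Rn R n T) p c = affine_comb (ring_at R c) n p"
  "power_space (affine_Rn R n T) p = power_space (Rn R n) p"
  by (simp_all add: affine_Rn_def power_space_def)

text \<open>
  On \<open>R\<^sup>n\<close> all axioms except the neighbourhood axiom are identities between affine combinations of
  arbitrary tuples, so they hold for every i-structure.
\<close>

lemma i_affine_spaceI:
  assumes T: "i_structure C (Rn R n) T"
    and neighbourhood: "\<And>q p c L P. c \<in> Ob C \<Longrightarrow> L \<in> {..<q} \<rightarrow> affine_coeffs (ring_at R c) p \<Longrightarrow>
      P \<in> T p c \<Longrightarrow> (\<lambda>a\<in>{..<q}. affine_comb (ring_at R c) n p (L a) P) \<in> T q c"
  shows "i_affine_space C R (affine_Rn R n T)"
proof -
  have tuple: "P \<in> {..<p} \<rightarrow>\<^sub>E vec (ring_at R c) n" if "c \<in> Ob C" "P \<in> T p c" for P p c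
  proof -
    have "is_subspace C (power_space (Rn R n) p) (T p)"
      using T unfolding i_structure_def by (rule conjunct1[THEN spec])
    then show ?thesis using that unfolding is_subspace_def pts_power_Rn by blast
  qed
  show ?thesis
    unfolding i_affine_space_def affine_Rn_simps
  proof (intro conjI allI ballI impI)
    show "is_space C (affine_Rn R n T)"
      using Rn_space unfolding is_space_def affine_Rn_simps .
    show "i_structure C (affine_Rn R n T) T"
      using T unfolding i_structure_def affine_Rn_simps .
  next
    fix p c l P assume "c \<in> Ob C" "l \<in> affine_coeffs (ring_at R c) p" "P \<in> T p c"
    then show "affine_comb (ring_at R c) n p l P \<in> pts (Rn R n) c"
      unfolding pts_Rn using affine_comb_in_vec[OF cring_at _ tuple] by blast
  next
    fix p d c f l P
    assume f: "f \<in> arrows C d c" and l: "l \<in> affine_coeffs (ring_at R c) p" and P: "P \<in> T p c"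
    show "rst (Rn R n) f (affine_comb (ring_at R c) n p l P) =
        affine_comb (ring_at R d) n p (rst (power_space (line R) p) f l)
          (rst (power_space (Rn R n) p) f P)"
      by (rule affine_comb_natural[OF f l tuple[OF arrow_objects(2)[OF f] P]])
  next
    fix q p :: nat and c L P assume "c \<in> Ob C" "L \<in> {..<q} \<rightarrow> affine_coeffs (ring_at R c) p" "P \<in> T p c"
    then show "(\<lambda>a\<in>{..<q}. affine_comb (ring_at R c) n p (L a) P) \<in> T q c"
      by (rule neighbourhood)
  next
    fix q p :: nat and c L P \<mu>
    assume c: "c \<in> Ob C" and L: "L \<in> {..<q} \<rightarrow> affine_coeffs (ring_at R c) p"
      and P: "P \<in> T p c" and \<mu>: "\<mu> \<in> affine_coeffs (ring_at R c) q"
    show "affine_comb (ring_at R c) n q \<mu> (\<lambda>a\<in>{..<q}. affine_comb (ring_at R c) n p (L a) P) =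
        affine_comb (ring_at R c) n p
          (\<lambda>j\<in>{..<p}. \<Oplus>\<^bsub>ring_at R c\<^esub>a\<in>{..<q}. \<mu> a \<otimes>\<^bsub>ring_at R c\<^esub> L a j) P"
      by (rule affine_comb_assoc[OF cring_at[OF c] tuple[OF c P] L \<mu>])
  next
    fix p k :: nat and c P assume k: "k < p" and c: "c \<in> Ob C" and P: "P \<in> T p c"
    show "affine_comb (ring_at R c) n p
        (\<lambda>j\<in>{..<p}. if j = k then \<one>\<^bsub>ring_at R c\<^esub> else \<zero>\<^bsub>ring_at R c\<^esub>) P = P k"
      by (rule affine_comb_proj[OF cring_at[OF c] tuple[OF c P] k])
  qed
qed

lemma kth_order_i_affine_space: "i_affine_space C R (affine_Rn R n (kth_order C R k n))"
proof (rule i_affine_spaceI[OF kth_order_i_structure])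
  fix q p :: nat and c L P
  assume c: "c \<in> Ob C" and L: "L \<in> {..<q} \<rightarrow> affine_coeffs (ring_at R c) p"
    and "P \<in> kth_order C R k n p c"
  then have P: "P \<in> {..<p} \<rightarrow>\<^sub>E vec (ring_at R c) n" "nilpotent_differences (ring_at R c) k n p P"
    by (simp_all add: kth_order_iff)
  show "(\<lambda>a\<in>{..<q}. affine_comb (ring_at R c) n p (L a) P) \<in> kth_order C R k n q c"
    unfolding kth_order_iff[OF c]
  proof
    show "(\<lambda>a\<in>{..<q}. affine_comb (ring_at R c) n p (L a) P) \<in> {..<q} \<rightarrow>\<^sub>E vec (ring_at R c) n"
      using L affine_comb_in_vec[OF cring_at[OF c] _ P(1)] by (simp add: Pi_iff)
  qed (rule nilpotent_differences_affine_comb[OF cring_at[OF c] P L])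
qed

lemma indiscrete_i_affine_space: "i_affine_space C R (affine_Rn R n (indiscrete (Rn R n)))"
proof (rule i_affine_spaceI[OF indiscrete_i_structure[OF Rn_space]])
  fix q p :: nat and c L P
  assume c: "c \<in> Ob C" and L: "L \<in> {..<q} \<rightarrow> affine_coeffs (ring_at R c) p"
    and "P \<in> indiscrete (Rn R n) p c"
  then show "(\<lambda>a\<in>{..<q}. affine_comb (ring_at R c) n p (L a) P) \<in> indiscrete (Rn R n) q c"
    using affine_comb_in_vec[OF cring_at[OF c]]
    by (simp add: indiscrete_def pts_power_Rn Pi_iff)
qed

lemma identity_i_affine_map:
  "i_affine_map C R (affine_Rn R n (kth_order C R k n)) (affine_Rn R n (indiscrete (Rn R n)))
     (\<lambda>c P. P)"
proof -
  have restrict: "(\<lambda>j\<in>{..<p}. P j) = P \<and> P \<in> indiscrete (Rn R n) p c"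
    if "c \<in> Ob C" "P \<in> kth_order C R k n p c" for p c P
    using that by (simp add: kth_order_iff indiscrete_def pts_power_Rn PiE_iff extensional_restrict)
  show ?thesis
    unfolding i_affine_map_def i_morphism_def is_map_def affine_Rn_simps
    using restrict by simp
qed

end

theorem theorem2:
  fixes C :: "('o, 'm) cat" and R :: "('o, 'm, 'r) ring_object" and k n :: nat
  assumes "small_category C"
    and "rational_algebra C R"
    and "kock_lawvere C R"
    and "k \<ge> 1" and "n \<ge> 1"
  shows "i_affine_space C R (affine_Rn R n (kth_order C R k n)) \<and>
    i_affine_space C R (affine_Rn R n (indiscrete (Rn R n))) \<and>
    i_affine_map C R (affine_Rn R n (kth_order C R k n)) (affine_Rn R n (indiscrete (Rn R n)))
      (\<lambda>c P. P)"
proof -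
  interpret algebra_object C R using assms(1,2) by unfold_locales
  show ?thesis
    using kth_order_i_affine_space indiscrete_i_affine_space identity_i_affine_map by blast
qed

end
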